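(* Let $\epsilon>0$, $\delta\in(0,1]$, $T\ge1$, and let $\gamma>0$ be a momentum parameter. Suppose $\|\lambda^{(0)}-\lambda^*\|_2\le M$ for some $M>0$. Suppose the multi-party resource-sharing algorithm with momentum updates described in the context is run with a fixed step-size $\nu^{(t)}=\nu$ for $T$ iterations with $(\epsilon,\delta)$-local differential privacy, i.e. with independent noise components $$\omega_{k,j}^{(t)}\sim\mathcal N\left(0,\frac{T\,m\,c_j^{2}}{2\rho(\epsilon,\delta)}\right),\qquad \rho(\epsilon,\delta)=\left(\sqrt{\log(1/\delta)+\epsilon}-\sqrt{\log(1/\delta)}\right)^{2},$$ $k=1,\dots,K$, $j=1,\dots,m$, $t=0,\dots,T-1$. Let $$B=\|c\|_2\left(\frac{T\,m\,K}{2\rho(\epsilon,\delta)}+(K-1)^2\right)^{1/2}.$$ Then $$\min_{t=0,1,\dots,T}\ \mathbb E[G^{(t)}]\le\frac{M^2}{2T\nu}+\frac{\nu}{2}B^2,$$ provided that the step-size satisfies $$0<\nu\le\frac{\sqrt{(G^{(0)})^2+(1-\gamma)B^2TM^2}-G^{(0)}}{B^2T}$$ (in particular, the quantity under the square root is nonnegative).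
   Context: Setting. There are $K>1$ parties and $m\ge 1$ shared resources with capacity vector $c\in[0,\infty)^m$, $c\neq0$. Party $k$ has a private dataset $\mathcal D_k=\{A_k,B_k,b_k,u_k\}$ with $A_k\in\mathbb R^{m\times n_k}$, $B_k\in\mathbb R^{m_k\times n_k}$, $b_k\in\mathbb R^{m_k}$, $u_k\in\mathbb R^{n_k}$. The resource-sharing problem is $$\max\ \sum_{k=1}^K u_k^\top x_k\quad\text{s.t.}\quad A_kx_k\le s_k,\ B_kx_k\le b_k,\ 0\le s_k\le c\ (k=1,\dots,K),\quad \sum_{k=1}^K s_k=c,$$ (the constraint $s_k\le c$ is assumed to be included for every party). Relaxing $\sum_k s_k=c$ with a multiplier $\lambda\in\mathbb R^m$ gives the Lagrangian $$\mathcal L(x,s,\lambda)=c^\top\lambda+\sum_{k=1}^K(u_k^\top x_k-s_k^\top\lambda),\qquad x=(x_1,\dots,x_K),\ s=(s_1,\dots,s_K),$$ and the sub-problems $$g(\lambda;\mathcal D_k)=\max_{x_k,s_k}\{u_k^\top x_k-s_k^\top\lambda:\ A_kx_k\le s_k,\ B_kx_k\le b_k,\ 0\le s_k\le c\}.$$ It is assumed that every sub-problem has an optimal solution for every $\lambda$ and that the resource-sharing problem has an optimal solution. The Lagrangian dual problem is $\min_\lambda\{c^\top\lambda+\sum_k g(\lambda;\mathcal D_k)\}$; $\lambda^*$ denotes an optimal solution of it and $(x^*,s^* )$ an optimal solution of the resource-sharing problem, so that $\mathcal L(x^*,s^*,\lambda^* )$ is the common optimal value. Algorithm. Start with $\lambda^{(-1)}=\lambda^{(0)}=0$.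 With step-sizes $\nu^{(t)}$ and momentum parameter $\gamma$, at each iteration $t$ perform $$(x_k^{(t)},s_k^{(t)})=\arg\max\, g(\lambda^{(t)};\mathcal D_k),\qquad \tilde s_k^{(t)}=s_k^{(t)}+\omega_k^{(t)},\qquad k=1,\dots,K,$$ $$\lambda^{(t+1)}=\lambda^{(t)}-\nu^{(t)}\Big(c-\sum_{k=1}^K\tilde s_k^{(t)}\Big)+\gamma\big(\lambda^{(t)}-\lambda^{(t-1)}\big),$$ where $\arg\max$ denotes a fixed (measurable) selection of a maximizer and $\omega_k^{(t)}=(\omega_{k,1}^{(t)},\dots,\omega_{k,m}^{(t)})$ are random noise vectors, independent over all $k,j,t$. Also $(x^{(T)},s^{(T)})$ denotes the sub-problem solutions at $\lambda^{(T)}$. Optimality gap: $G^{(t)}=\mathcal L(x^{(t)},s^{(t)},\lambda^{(t)})-\mathcal L(x^*,s^*,\lambda^* )$ for $t\ge0$ (note that $G^{(0)}$ is deterministic). $\mathcal N(0,0)$ denotes the point mass at $0$. *)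

theory Defs
  imports "HOL-Probability.Probability"
begin

(* The m shared resources are indexed by the finite type 'm, so R^m is real^'m. The private
   dimensions vary with the party, so R^n is the set of functions {..<n} \<rightarrow>\<^sub>E UNIV;
   entries of the matrices and vectors below outside the stated ranges are never used. *)
record 'm dataset =
  n_vars :: nat
  n_rows :: nat
  A_mat :: "'m \<Rightarrow> nat \<Rightarrow> real"
  B_mat :: "nat \<Rightarrow> nat \<Rightarrow> real"
  b_vec :: "nat \<Rightarrow> real"
  u_vec :: "nat \<Rightarrow> real"

definition utility :: "'m dataset \<Rightarrow> (nat \<Rightarrow> real) \<Rightarrow> real" where
  "utility D x = (\<Sum>i<n_vars D. u_vec D i * x i)"

(* The order on real^'m is the componentwise one. *)
definition sub_feasible ::
  "real^'m \<Rightarrow> 'm::finite dataset \<Rightarrow> ((nat \<Rightarrow> real) \<times> (real^'m)) set" where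
  "sub_feasible c D = {(x, s).
     x \<in> {..<n_vars D} \<rightarrow>\<^sub>E UNIV \<and>
     (\<forall>j. (\<Sum>i<n_vars D. A_mat D j i * x i) \<le> s $ j) \<and>
     (\<forall>r<n_rows D. (\<Sum>i<n_vars D. B_mat D r i * x i) \<le> b_vec D r) \<and>
     0 \<le> s \<and> s \<le> c}"

definition sub_objective ::
  "'m::finite dataset \<Rightarrow> real^'m \<Rightarrow> (nat \<Rightarrow> real) \<times> (real^'m) \<Rightarrow> real" where
  "sub_objective D l = (\<lambda>(x, s). utility D x - s \<bullet> l)"

definition sub_optimal ::
  "real^'m \<Rightarrow> 'm::finite dataset \<Rightarrow> real^'m \<Rightarrow> (nat \<Rightarrow> real) \<times> (real^'m) \<Rightarrow> bool" where
  "sub_optimal c D l z \<longleftrightarrow> is_arg_max (sub_objective D l) (\<lambda>z. z \<in> sub_feasible c D) z"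

(* g(l; D); the supremum is a maximum whenever the sub-problem has an optimal solution. *)
definition sub_value :: "real^'m \<Rightarrow> 'm::finite dataset \<Rightarrow> real^'m \<Rightarrow> real" where
  "sub_value c D l = (SUP z\<in>sub_feasible c D. sub_objective D l z)"

definition rs_optimal ::
  "nat \<Rightarrow> real^'m \<Rightarrow> (nat \<Rightarrow> 'm::finite dataset) \<Rightarrow>
   (nat \<Rightarrow> nat \<Rightarrow> real) \<Rightarrow> (nat \<Rightarrow> real^'m) \<Rightarrow> bool" where
  "rs_optimal K c D x s \<longleftrightarrow>
     is_arg_max (\<lambda>(x, s). \<Sum>k=1..K. utility (D k) (x k))
       (\<lambda>(x, s). (\<forall>k\<in>{1..K}. (x k, s k) \<in> sub_feasible c (D k)) \<and> (\<Sum>k=1..K. s k) = c)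
       (x, s)"

definition lagrangian ::
  "nat \<Rightarrow> real^'m \<Rightarrow> (nat \<Rightarrow> 'm::finite dataset) \<Rightarrow>
   (nat \<Rightarrow> nat \<Rightarrow> real) \<Rightarrow> (nat \<Rightarrow> real^'m) \<Rightarrow> real^'m \<Rightarrow> real" where
  "lagrangian K c D x s l = c \<bullet> l + (\<Sum>k=1..K. utility (D k) (x k) - s k \<bullet> l)"

definition dual_optimal ::
  "nat \<Rightarrow> real^'m \<Rightarrow> (nat \<Rightarrow> 'm::finite dataset) \<Rightarrow> real^'m \<Rightarrow> bool" where
  "dual_optimal K c D l \<longleftrightarrow>
     is_arg_min (\<lambda>l. c \<bullet> l + (\<Sum>k=1..K. sub_value c (D k) l)) (\<lambda>l. True) l"

definition rs_setting :: "nat \<Rightarrow> real^'m \<Rightarrow> (nat \<Rightarrow> 'm::finite dataset) \<Rightarrow> bool" where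
  "rs_setting K c D \<longleftrightarrow> 1 < K \<and> 0 \<le> c \<and> c \<noteq> 0 \<and>
     (\<forall>k\<in>{1..K}. \<forall>l. \<exists>z. sub_optimal c (D k) l z) \<and>
     (\<exists>x s. rs_optimal K c D x s)"

(* sel k is the fixed choice of a maximizer of the k-th sub-problem as a function of the
   multiplier; it is measurable as a map from R^m to R^(n_k) x R^m. *)
definition argmax_selection ::
  "nat \<Rightarrow> real^'m \<Rightarrow> (nat \<Rightarrow> 'm::finite dataset) \<Rightarrow>
   (nat \<Rightarrow> real^'m \<Rightarrow> (nat \<Rightarrow> real) \<times> (real^'m)) \<Rightarrow> bool" where
  "argmax_selection K c D sel \<longleftrightarrow> (\<forall>k\<in>{1..K}.
     (\<forall>l. sub_optimal c (D k) l (sel k l)) \<and>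
     sel k \<in> borel \<rightarrow>\<^sub>M (Pi\<^sub>M {..<n_vars (D k)} (\<lambda>_. borel)) \<Otimes>\<^sub>M borel)"

(* The pair of multipliers at times t - 1 and t, for a noise realization w, where w k t is the
   noise vector of party k at iteration t; at t = 0 both multipliers are 0. *)
primrec alg_state ::
  "nat \<Rightarrow> real^'m \<Rightarrow> (nat \<Rightarrow> real^'m \<Rightarrow> (nat \<Rightarrow> real) \<times> (real^'m)) \<Rightarrow>
   (nat \<Rightarrow> real) \<Rightarrow> real \<Rightarrow> (nat \<Rightarrow> nat \<Rightarrow> real^'m) \<Rightarrow> nat \<Rightarrow> (real^'m) \<times> (real^'m::finite)" where
  "alg_state K c sel \<nu> \<gamma> w 0 = (0, 0)"
| "alg_state K c sel \<nu> \<gamma> w (Suc t) =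
     (let (l', l) = alg_state K c sel \<nu> \<gamma> w t in
       (l, l - \<nu> t *\<^sub>R (c - (\<Sum>k=1..K. snd (sel k l) + w k t)) + \<gamma> *\<^sub>R (l - l')))"

definition multiplier ::
  "nat \<Rightarrow> real^'m \<Rightarrow> (nat \<Rightarrow> real^'m \<Rightarrow> (nat \<Rightarrow> real) \<times> (real^'m)) \<Rightarrow>
   (nat \<Rightarrow> real) \<Rightarrow> real \<Rightarrow> (nat \<Rightarrow> nat \<Rightarrow> real^'m) \<Rightarrow> nat \<Rightarrow> real^'m::finite" where
  "multiplier K c sel \<nu> \<gamma> w t = snd (alg_state K c sel \<nu> \<gamma> w t)"

(* The optimality gap as a function of the current multiplier l; here (xs, ss) and ls are the
   primal and dual optimal solutions. *)
definition opt_gap ::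
  "nat \<Rightarrow> real^'m \<Rightarrow> (nat \<Rightarrow> 'm::finite dataset) \<Rightarrow>
   (nat \<Rightarrow> real^'m \<Rightarrow> (nat \<Rightarrow> real) \<times> (real^'m)) \<Rightarrow>
   (nat \<Rightarrow> nat \<Rightarrow> real) \<Rightarrow> (nat \<Rightarrow> real^'m) \<Rightarrow> real^'m \<Rightarrow> real^'m \<Rightarrow> real" where
  "opt_gap K c D sel xs ss ls l =
     lagrangian K c D (\<lambda>k. fst (sel k l)) (\<lambda>k. snd (sel k l)) l - lagrangian K c D xs ss ls"

(* The second argument is the variance (normal_density takes the standard deviation);
   variance 0 gives the point mass. *)
definition normal_law :: "real \<Rightarrow> real \<Rightarrow> real measure" where
  "normal_law \<mu> v = (if v = 0 then return borel \<mu>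
     else density lborel (\<lambda>x. ennreal (normal_density \<mu> (sqrt v) x)))"

definition rho :: "real \<Rightarrow> real \<Rightarrow> real" where
  "rho \<epsilon> \<delta> = (sqrt (ln (1 / \<delta>) + \<epsilon>) - sqrt (ln (1 / \<delta>)))\<^sup>2"

end

theory Submission
  imports Defs
begin

text \<open>
  The optimality gap at a multiplier \<open>l\<close> is the dual gap \<open>d l - d ls\<close>, where \<open>d\<close> is the dual
  function. Indeed the Lagrangian at the selected maximisers equals \<open>d l\<close>, and strong duality
  (\<open>strong_duality\<close>) identifies the optimal value of the resource-sharing problem with the minimum
  of \<open>d\<close> (\<open>opt_gap_eq\<close>). Strong duality is obtained by separating a point from the sum of the
  parties' hypographs of (allocation, utility). This sum is closed because each hypograph is a
  projection of a polyhedron, hence closed by Fourier--Motzkin elimination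
  (\<open>closed_ex_finite_linear_system\<close>), and becomes compact when the utility is bounded below
  (\<open>compact_truncated_sum\<close>).

  The algorithm is the heavy-ball method for the convex function \<open>d\<close> with noisy subgradients: the
  residual \<open>c - \<Sum> s\<^sub>k\<close> is a subgradient of norm at most \<open>(K - 1) \<parallel>c\<parallel>\<close>, and the noise is centred and
  independent of the past, with a variance that makes \<open>B\<^sup>2\<close> a bound for the second moment of
  the noisy subgradient. The shifted points \<open>l\<^sub>t + \<gamma> / (1 - \<gamma>) (l\<^sub>t - l\<^bsub>t-1\<^esub>)\<close> perform
  plain subgradient steps of size \<open>\<nu> / (1 - \<gamma>)\<close> (\<open>heavy_ball_energy\<close>), so the usual telescoping of
  squared distances to \<open>ls\<close> bounds the sum of the expected gaps, up to a telescoping momentum term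
  that contributes the initial gap \<open>G0\<close> (\<open>expected_regret\<close>).

  The upper bound on the step-size is equivalent to
  \<open>T \<nu>\<^sup>2 B\<^sup>2 + 2 \<nu> G0 \<le> (1 - \<gamma>) M\<^sup>2\<close> (\<open>stepsize_condition\<close>), which is exactly what is needed for the
  cost of the momentum not to exceed its gain (\<open>momentum_average_bound\<close>). The average of the
  expected gaps, and hence their minimum, then obeys the bound of the method without momentum.
\<close>

section \<open>Projections of finite linear systems\<close>

lemma separating_point_finite:
  fixes L U :: "'a::linorder set"
  assumes "finite L" "finite U" and "\<And>l u. l \<in> L \<Longrightarrow> u \<in> U \<Longrightarrow> l \<le> u"
  shows "\<exists>z. (\<forall>l\<in>L. l \<le> z) \<and> (\<forall>u\<in>U. z \<le> u)"
proof (cases "L = {}")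
  case True
  show ?thesis
  proof (cases "U = {}")
    case False
    then show ?thesis
      using True \<open>finite U\<close> by (intro exI[of _ "Min U"]) auto
  qed (use True in auto)
next
  case False
  then show ?thesis
    using assms by (intro exI[of _ "Max L"]) auto
qed

text \<open>
  Fourier--Motzkin elimination, carried out only as far as closedness. Eliminating the variable
  \<open>v\<close> pairs every row bounding it from above with every row bounding it from below. The
  right-hand sides of the new rows are linear combinations of the old ones, so they stay
  continuous, and an induction on the set of variables ends with finitely many closed conditions
  \<open>0 \<le> f y\<close>. Keeping the right-hand sides as arbitrary continuous functions avoids tracking
  the multipliers.
\<close>

lemma closed_ex_finite_linear_system:
  fixes R :: "(('v \<Rightarrow> real) \<times> ('y::topological_space \<Rightarrow> real)) set"
  assumes "finite V" "finite R" and "\<And>a f. (a, f) \<in> R \<Longrightarrow> continuous_on UNIV f"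
  shows "closed {y. \<exists>x. \<forall>(a, f)\<in>R. (\<Sum>v\<in>V. a v * x v) \<le> f y}"
  using assms
proof (induction V arbitrary: R rule: finite_induct)
  case empty
  have "{y. \<exists>x. \<forall>(a, f)\<in>R. (\<Sum>v\<in>{}. a v * x v) \<le> f y} = (\<Inter>(a, f)\<in>R. {y. 0 \<le> f y})"
    by auto
  also have "closed \<dots>"
    using empty.prems(2) by (intro closed_INT) (auto intro!: closed_Collect_le)
  finally show ?case .
next
  case (insert v V)
  \<comment> \<open>\<open>comb\<close> divides an upper and a lower row by the coefficient of \<open>v\<close> and subtracts, which
  cancels \<open>v\<close>.\<close>
  define up where "up = {r \<in> R. fst r v > 0}"
  define low where "low = {r \<in> R. fst r v < 0}"
  define comb :: "(('v \<Rightarrow> real) \<times> ('y \<Rightarrow> real)) \<times> (('v \<Rightarrow> real) \<times> ('y \<Rightarrow> real)) \<Rightarrow> _"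
    where "comb = (\<lambda>(p, q). (\<lambda>w. fst p w / fst p v - fst q w / fst q v,
                              \<lambda>y. snd p y / fst p v - snd q y / fst q v))"
  define R' where "R' = {r \<in> R. fst r v = 0} \<union> comb ` (up \<times> low)"
  have comb_row: "(\<Sum>w\<in>V. fst (comb (p, q)) w * x w) =
      (\<Sum>w\<in>V. fst p w * x w) / fst p v - (\<Sum>w\<in>V. fst q w * x w) / fst q v" for p q x
    by (simp add: comb_def algebra_simps sum_subtractf sum_divide_distrib)
  have solvable_iff: "(\<exists>x. \<forall>(a, f)\<in>R. (\<Sum>w\<in>insert v V. a w * x w) \<le> f y) \<longleftrightarrow>
      (\<exists>x. \<forall>(a, f)\<in>R'. (\<Sum>w\<in>V. a w * x w) \<le> f y)" for y
  proof
    assume "\<exists>x. \<forall>(a, f)\<in>R. (\<Sum>w\<in>insert v V. a w * x w) \<le> f y"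
    then obtain x where x: "\<And>r. r \<in> R \<Longrightarrow> fst r v * x v + (\<Sum>w\<in>V. fst r w * x w) \<le> snd r y"
      using insert.hyps by fastforce
    have "(\<Sum>w\<in>V. fst r w * x w) \<le> snd r y" if "r \<in> R'" for r
    proof (cases "r \<in> R \<and> fst r v = 0")
      case True
      then show ?thesis using x[of r] by simp
    next
      case False
      then obtain p q where r: "r = comb (p, q)" and p: "p \<in> R" "fst p v > 0"
        and q: "q \<in> R" "fst q v < 0"
        using \<open>r \<in> R'\<close> by (auto simp: R'_def up_def low_def)
      have "x v \<le> (snd p y - (\<Sum>w\<in>V. fst p w * x w)) / fst p v"
        using x[OF p(1)] p(2) by (simp add: field_simps)
      moreover have "(snd q y - (\<Sum>w\<in>V. fst q w * x w)) / fst q v \<le> x v"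
        using x[OF q(1)] q(2) by (simp add: field_simps)
      ultimately show ?thesis
        unfolding r comb_row by (simp add: comb_def diff_divide_distrib)
    qed
    then show "\<exists>x. \<forall>(a, f)\<in>R'. (\<Sum>w\<in>V. a w * x w) \<le> f y"
      by (intro exI[of _ x]) auto
  next
    assume "\<exists>x. \<forall>(a, f)\<in>R'. (\<Sum>w\<in>V. a w * x w) \<le> f y"
    then obtain x where x: "\<And>r. r \<in> R' \<Longrightarrow> (\<Sum>w\<in>V. fst r w * x w) \<le> snd r y"
      by fastforce
    \<comment> \<open>The bound that row \<open>r\<close> puts on the value of \<open>v\<close> once the other variables are fixed: an
    upper bound if \<open>r\<close> is in \<open>up\<close>, a lower bound if \<open>r\<close> is in \<open>low\<close>.\<close>
    define bd where "bd r = (snd r y - (\<Sum>w\<in>V. fst r w * x w)) / fst r v" for r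
    have "bd q \<le> bd p" if "p \<in> up" "q \<in> low" for p q
    proof -
      have "comb (p, q) \<in> R'"
        using that by (auto simp: R'_def)
      from x[OF this] show ?thesis
        unfolding comb_row by (simp add: bd_def comb_def diff_divide_distrib)
    qed
    moreover have "finite up" "finite low"
      using insert.prems by (auto simp: up_def low_def)
    ultimately obtain z where z: "\<And>q. q \<in> low \<Longrightarrow> bd q \<le> z" "\<And>p. p \<in> up \<Longrightarrow> z \<le> bd p"
      using separating_point_finite[of "bd ` low" "bd ` up"] by fastforce
    have "fst r v * z + (\<Sum>w\<in>V. fst r w * x w) \<le> snd r y" if "r \<in> R" for r
    proof -
      consider "fst r v = 0" | "fst r v > 0" | "fst r v < 0" by linarith
      then show ?thesis
      proof cases
        case 1
        then show ?thesis using x[of r] that by (simp add: R'_def)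
      next
        case 2
        then show ?thesis using z(2)[of r] that by (simp add: up_def bd_def field_simps)
      next
        case 3
        then show ?thesis using z(1)[of r] that by (simp add: low_def bd_def field_simps)
      qed
    qed
    moreover have "(\<Sum>w\<in>V. a w * (x(v := z)) w) = (\<Sum>w\<in>V. a w * x w)" for a
      using insert.hyps by (intro sum.cong) auto
    ultimately show "\<exists>x. \<forall>(a, f)\<in>R. (\<Sum>w\<in>insert v V. a w * x w) \<le> f y"
      using insert.hyps by (intro exI[of _ "x(v := z)"]) fastforce
  qed
  have "finite R'"
    using insert.prems by (auto simp: R'_def up_def low_def)
  moreover have "continuous_on UNIV f" if "(a, f) \<in> R'" for a f
  proof -
    have cont: "continuous_on UNIV (snd r)" if "r \<in> R" for r
      using that insert.prems(2)[of "fst r" "snd r"] by simp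
    show ?thesis
      using that by (auto simp: R'_def up_def low_def comb_def intro!: continuous_intros
          dest: cont)
  qed
  ultimately show ?case
    using insert.IH[of R'] by (simp only: solvable_iff)
qed

section \<open>Strong duality for the resource-sharing problem\<close>

text \<open>
  The hypograph of the value function that maps an allocation \<open>s\<close> to the best utility attainable
  under it.
\<close>

definition hypograph :: "real^'m \<Rightarrow> 'm::finite dataset \<Rightarrow> ((real^'m) \<times> real) set" where
  "hypograph c D = {(s, v). \<exists>x. (x, s) \<in> sub_feasible c D \<and> v \<le> utility D x}"

text \<open>
  Restricting \<open>x\<close> to the relevant indices changes no constraint, so extensionality of \<open>x\<close> can be
  dropped; this makes the hypograph the projection of a plain linear system.
\<close>

lemma hypograph_iff:
  "(s, v) \<in> hypograph c D \<longleftrightarrow>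
     (\<exists>x. (\<forall>j. (\<Sum>i<n_vars D. A_mat D j i * x i) \<le> s $ j) \<and>
       (\<forall>r<n_rows D. (\<Sum>i<n_vars D. B_mat D r i * x i) \<le> b_vec D r) \<and>
       0 \<le> s \<and> s \<le> c \<and> v \<le> utility D x)" (is "_ \<longleftrightarrow> (\<exists>x. ?Q x)")
proof
  assume "\<exists>x. ?Q x"
  then obtain x where "?Q x" by blast
  then have "(restrict x {..<n_vars D}, s) \<in> sub_feasible c D \<and>
      v \<le> utility D (restrict x {..<n_vars D})"
    by (simp add: sub_feasible_def utility_def)
  then show "(s, v) \<in> hypograph c D"
    by (auto simp: hypograph_def)
qed (auto simp: hypograph_def sub_feasible_def)

lemma closed_hypograph: "closed (hypograph c D)"
proof -
  define R :: "((nat \<Rightarrow> real) \<times> ((real^'a) \<times> real \<Rightarrow> real)) set" where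
    "R = range (\<lambda>j. (A_mat D j, \<lambda>y. fst y $ j)) \<union>
         (\<lambda>r. (B_mat D r, \<lambda>y. b_vec D r)) ` {..<n_rows D} \<union>
         range (\<lambda>j. (\<lambda>_. 0, \<lambda>y. fst y $ j)) \<union>
         range (\<lambda>j. (\<lambda>_. 0, \<lambda>y. c $ j - fst y $ j)) \<union>
         {(\<lambda>i. - u_vec D i, \<lambda>y. - snd y)}"
  have rows: "(\<forall>(a, f)\<in>R. (\<Sum>i<n_vars D. a i * x i) \<le> f (s, v)) \<longleftrightarrow>
       (\<forall>j. (\<Sum>i<n_vars D. A_mat D j i * x i) \<le> s $ j) \<and>
       (\<forall>r<n_rows D. (\<Sum>i<n_vars D. B_mat D r i * x i) \<le> b_vec D r) \<and>
       0 \<le> s \<and> s \<le> c \<and> v \<le> utility D x" for x s v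
    by (auto simp: R_def less_eq_vec_def utility_def sum_negf ball_Un)
  have "hypograph c D = {y. \<exists>x. \<forall>(a, f)\<in>R. (\<Sum>i<n_vars D. a i * x i) \<le> f y}"
    by (intro set_eqI) (simp only: split_paired_all hypograph_iff rows mem_Collect_eq)
  moreover have "closed \<dots>"
    by (rule closed_ex_finite_linear_system)
      (auto simp: R_def intro!: continuous_intros)
  ultimately show ?thesis by simp
qed

lemma convex_hypograph: "convex (hypograph c D)"
proof (rule convexI)
  fix p q :: "(real^'a) \<times> real" and a b :: real
  assume p: "p \<in> hypograph c D" and q: "q \<in> hypograph c D" and ab: "0 \<le> a" "0 \<le> b" "a + b = 1"
  obtain s v s' v' where pq: "p = (s, v)" "q = (s', v')"
    by (cases p, cases q) 
  obtain x where x: "\<And>j. (\<Sum>i<n_vars D. A_mat D j i * x i) \<le> s $ j"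
      "\<And>r. r<n_rows D \<Longrightarrow> (\<Sum>i<n_vars D. B_mat D r i * x i) \<le> b_vec D r"
      "0 \<le> s" "s \<le> c" "v \<le> utility D x"
    using p unfolding pq hypograph_iff by blast
  obtain x' where x': "\<And>j. (\<Sum>i<n_vars D. A_mat D j i * x' i) \<le> s' $ j"
      "\<And>r. r<n_rows D \<Longrightarrow> (\<Sum>i<n_vars D. B_mat D r i * x' i) \<le> b_vec D r"
      "0 \<le> s'" "s' \<le> c" "v' \<le> utility D x'"
    using q unfolding pq hypograph_iff by blast
  have lin: "(\<Sum>i<n_vars D. f i * (a * x i + b * x' i)) =
      a * (\<Sum>i<n_vars D. f i * x i) + b * (\<Sum>i<n_vars D. f i * x' i)" for f
    by (simp add: algebra_simps sum.distrib sum_distrib_left)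
  have bound: "a * d + b * d' \<le> e" if "d \<le> e" "d' \<le> e" for d d' e :: real
    using that ab by (simp add: convex_bound_le)
  show "a *\<^sub>R p + b *\<^sub>R q \<in> hypograph c D"
    unfolding pq scaleR_Pair add_Pair hypograph_iff
  proof (intro exI[of _ "\<lambda>i. a * x i + b * x' i"] conjI allI impI)
    show "0 \<le> a *\<^sub>R s + b *\<^sub>R s'"
      using x x' ab by (simp add: less_eq_vec_def)
    show "a *\<^sub>R s + b *\<^sub>R s' \<le> c"
      using x x' by (auto simp: less_eq_vec_def intro!: bound)
    show "a *\<^sub>R v + b *\<^sub>R v' \<le> utility D (\<lambda>i. a * x i + b * x' i)"
      using x x' ab by (simp add: utility_def lin add_mono mult_left_mono)
    show "(\<Sum>i<n_vars D. A_mat D j i * (a * x i + b * x' i)) \<le> (a *\<^sub>R s + b *\<^sub>R s') $ j" for j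
      using x(1)[of j] x'(1)[of j] ab by (simp add: lin add_mono mult_left_mono)
  qed (use x x' in \<open>auto simp: lin intro!: bound\<close>)
qed

text \<open>
  A Minkowski sum of closed sets need not be closed. Here every summand is bounded above in its
  last coordinate and becomes compact once that coordinate is bounded below. If the last
  coordinates add up to at least \<open>N\<close>, then each of them is bounded below by \<open>N\<close> minus the upper
  bounds of the others, so the truncated sum is a closed part of a sum of compact sets.
\<close>

lemma compact_truncated_sum:
  fixes H :: "'i \<Rightarrow> ('b::real_normed_vector \<times> real) set"
  assumes "finite I" and "\<And>i N. i \<in> I \<Longrightarrow> compact (H i \<inter> {y. N \<le> snd y})"
    and "\<And>i y. i \<in> I \<Longrightarrow> y \<in> H i \<Longrightarrow> snd y \<le> V i"
  shows "compact ((\<Sum>i\<in>I. H i) \<inter> {y. N \<le> snd y}) \<and> (\<forall>y\<in>(\<Sum>i\<in>I. H i). snd y \<le> (\<Sum>i\<in>I. V i))"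
  using assms
proof (induction I arbitrary: N rule: finite_induct)
  case empty
  show ?case
    by (simp add: finite_imp_compact)
next
  case (insert i I)
  let ?S = "\<Sum>i\<in>I. H i" and ?W = "\<Sum>i\<in>I. V i"
  have IH: "compact (?S \<inter> {y. N \<le> snd y})" "\<forall>y\<in>?S. snd y \<le> ?W" for N
    using insert.IH insert.prems by auto
  let ?C = "{x + y | x y. x \<in> H i \<inter> {y. N - ?W \<le> snd y} \<and> y \<in> ?S \<inter> {y. N - V i \<le> snd y}}"
  have "(H i + ?S) \<inter> {y. N \<le> snd y} = ?C \<inter> {y. N \<le> snd y}"
  proof (intro equalityI subsetI)
    fix z assume "z \<in> (H i + ?S) \<inter> {y. N \<le> snd y}"
    then obtain x y where z: "z = x + y" "x \<in> H i" "y \<in> ?S" "N \<le> snd x + snd y"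
      by (auto simp: set_plus_def)
    have "snd x \<le> V i" "snd y \<le> ?W"
      using z insert.prems IH(2) by auto
    then have "x \<in> H i \<inter> {y. N - ?W \<le> snd y}" "y \<in> ?S \<inter> {y. N - V i \<le> snd y}"
      using z by auto
    then have "z \<in> ?C"
      unfolding z(1) by blast
    then show "z \<in> ?C \<inter> {y. N \<le> snd y}"
      using z by simp
  next
    fix z assume z: "z \<in> ?C \<inter> {y. N \<le> snd y}"
    then have "z \<in> H i + ?S"
      unfolding set_plus_def by blast
    then show "z \<in> (H i + ?S) \<inter> {y. N \<le> snd y}"
      using z by simp
  qed
  moreover have "compact (?C \<inter> {y. N \<le> snd y})"
  proof (intro compact_Int_closed[OF compact_sums])
    show "compact (H i \<inter> {y. N - ?W \<le> snd y})" "compact (?S \<inter> {y. N - V i \<le> snd y})"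
      using IH(1) insert.prems(1) by auto
    show "closed {y::'b \<times> real. N \<le> snd y}"
      by (intro closed_Collect_le continuous_intros)
  qed
  moreover have "snd y \<le> V i + ?W" if y: "y \<in> H i + ?S" for y
  proof -
    obtain p q where "y = p + q" "p \<in> H i" "q \<in> ?S"
      using y by (auto simp: set_plus_def)
    then show ?thesis
      using insert.prems(2)[of i p] IH(2) by (auto intro!: add_mono)
  qed
  ultimately show ?case
    using insert.hyps by simp
qed

text \<open>
  A convergent sequence has bounded last coordinates and therefore stays in a single truncation.
\<close>

lemma closed_if_truncations_closed:
  fixes S :: "('b::metric_space \<times> real) set"
  assumes "\<And>N. closed (S \<inter> {y. N \<le> snd y})"
  shows "closed S"
  unfolding closed_sequential_limits
proof safe
  fix X a b assume X: "\<forall>n. X n \<in> S" "X \<longlonglongrightarrow> (a, b)"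
  have "(\<lambda>n. snd (X n)) \<longlonglongrightarrow> b"
    using X(2) tendsto_snd by fastforce
  then obtain N where "\<forall>n. N \<le> snd (X n)"
    by (metis Bseq_eq_bounded bounded_imp_bdd_below convergentI convergent_imp_Bseq bdd_below.E rangeI)
  then have "\<forall>n. X n \<in> S \<inter> {y. N \<le> snd y}"
    using X(1) by auto
  then show "(a, b) \<in> S"
    using assms[of N] X(2) unfolding closed_sequential_limits by blast
qed

lemma sub_value_eq:
  assumes "sub_optimal c D l z"
  shows "sub_value c D l = sub_objective D l z"
proof -
  have "z \<in> sub_feasible c D" "\<forall>z'\<in>sub_feasible c D. sub_objective D l z' \<le> sub_objective D l z"
    using assms by (auto simp only: sub_optimal_def is_arg_max_linorder)
  then show ?thesis
    unfolding sub_value_def by (intro cSup_eq_maximum) auto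
qed

lemma sub_objective_le_sub_value:
  assumes "\<exists>z'. sub_optimal c D l z'" "z \<in> sub_feasible c D"
  shows "sub_objective D l z \<le> sub_value c D l"
proof -
  obtain z' where z': "sub_optimal c D l z'"
    using assms(1) by blast
  then have "sub_objective D l z \<le> sub_objective D l z'"
    using assms(2) by (simp only: sub_optimal_def is_arg_max_linorder)
  then show ?thesis
    using sub_value_eq[OF z'] by simp
qed

text \<open>
  Allocations range over the box between \<open>0\<close> and \<open>c\<close>, and the sub-problem at multiplier \<open>0\<close>,
  being solvable, bounds the utility.
\<close>

lemma compact_truncated_hypograph:
  assumes "\<exists>z. sub_optimal c D 0 z"
  shows "compact (hypograph c D \<inter> {y. N \<le> snd y})"
    and "y \<in> hypograph c D \<Longrightarrow> snd y \<le> sub_value c D 0"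
proof -
  have le: "snd y \<le> sub_value c D 0" if y: "y \<in> hypograph c D" for y
  proof -
    obtain x where "(x, fst y) \<in> sub_feasible c D" "snd y \<le> utility D x"
      using y by (auto simp: hypograph_def case_prod_beta)
    then show ?thesis
      using sub_objective_le_sub_value[OF assms] by (fastforce simp: sub_objective_def)
  qed
  then show "y \<in> hypograph c D \<Longrightarrow> snd y \<le> sub_value c D 0" .
  have "hypograph c D \<inter> {y. N \<le> snd y} = ({0..c} \<times> {N..sub_value c D 0}) \<inter> hypograph c D"
    (is "?L = ?R")
  proof (intro equalityI subsetI)
    fix y assume y: "y \<in> ?L"
    then have "fst y \<in> {0..c}"
      by (auto simp: hypograph_def sub_feasible_def)
    then show "y \<in> ?R"
      using y le[of y] by (simp add: mem_Times_iff)
  qed auto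
  then show "compact (hypograph c D \<inter> {y. N \<le> snd y})"
    by (simp add: compact_Int_closed compact_Times closed_hypograph)
qed

definition dual_fun :: "nat \<Rightarrow> real^'m \<Rightarrow> (nat \<Rightarrow> 'm::finite dataset) \<Rightarrow> real^'m \<Rightarrow> real" where
  "dual_fun K c D l = c \<bullet> l + (\<Sum>k=1..K. sub_value c (D k) l)"

lemma weak_duality:
  assumes "rs_setting K c D" "rs_optimal K c D xs ss"
  shows "(\<Sum>k=1..K. utility (D k) (xs k)) \<le> dual_fun K c D l"
proof -
  have feas: "\<And>k. k \<in> {1..K} \<Longrightarrow> (xs k, ss k) \<in> sub_feasible c (D k)" "(\<Sum>k=1..K. ss k) = c"
    using assms(2) by (auto simp: rs_optimal_def is_arg_max_def)
  have "(\<Sum>k=1..K. utility (D k) (xs k)) = c \<bullet> l + (\<Sum>k=1..K. utility (D k) (xs k) - ss k \<bullet> l)"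
    using feas(2) by (simp add: sum_subtractf flip: inner_sum_left)
  also have "\<dots> \<le> dual_fun K c D l"
    unfolding dual_fun_def
    using sub_objective_le_sub_value feas(1) assms(1)
    by (intro add_left_mono sum_mono) (force simp: rs_setting_def sub_objective_def)
  finally show ?thesis .
qed

text \<open>
  If the dual value \<open>q\<close> exceeded the primal value \<open>p\<close>, then \<open>(c, q)\<close> would lie outside the
  sum of the hypographs, which is closed and convex, whereas \<open>(c, p)\<close> lies in it. A hyperplane
  separating \<open>(c, q)\<close> from the sum cannot be vertical, since the two points differ only in the
  last coordinate; its slope is therefore a multiplier, and at this multiplier the dual function is
  smaller than \<open>q\<close>.
\<close>

theorem strong_duality:
  assumes setting: "rs_setting K c D" and primal: "rs_optimal K c D xs ss"
    and dual: "dual_optimal K c D ls"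
  shows "dual_fun K c D ls = (\<Sum>k=1..K. utility (D k) (xs k))"
proof (rule ccontr)
  let ?q = "dual_fun K c D ls" and ?p = "\<Sum>k=1..K. utility (D k) (xs k)"
  let ?H = "\<Sum>k=1..K. hypograph c (D k)"
  assume "?q \<noteq> ?p"
  then have less: "?p < ?q"
    using weak_duality[OF setting primal, of ls] by linarith
  have opt: "\<exists>z. sub_optimal c (D k) l z" if "k \<in> {1..K}" for k l
    using setting that by (auto simp: rs_setting_def)
  have best: "(\<Sum>k=1..K. utility (D k) (x k)) \<le> ?p"
    if "\<forall>k\<in>{1..K}. (x k, s k) \<in> sub_feasible c (D k)" "(\<Sum>k=1..K. s k) = c" for x s
    using primal that unfolding rs_optimal_def is_arg_max_linorder
    by (auto dest!: spec[of _ "(x, s)"])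
  have compact_k: "compact (hypograph c (D k) \<inter> {y. N \<le> snd y})" if "k \<in> {1..K}" for k N
    by (rule compact_truncated_hypograph(1)) (rule opt[OF that])
  have bounded_k: "snd y \<le> sub_value c (D k) 0" if "k \<in> {1..K}" "y \<in> hypograph c (D k)" for k y
    using that(2) by (rule compact_truncated_hypograph(2)[rotated]) (rule opt[OF that(1)])
  have "compact (?H \<inter> {y. N \<le> snd y})" for N
    by (rule conjunct1[OF compact_truncated_sum[where V = "\<lambda>k. sub_value c (D k) 0"]])
      (simp_all only: finite_atLeastAtMost compact_k bounded_k)
  then have "closed ?H"
    by (rule closed_if_truncations_closed[OF compact_imp_closed])
  moreover have "convex ?H"
    by (intro convex_set_sum convex_hypograph)
  moreover have "(c, ?q) \<notin> ?H"
  proof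
    assume "(c, ?q) \<in> ?H"
    then obtain p where p: "(c, ?q) = (\<Sum>k=1..K. p k)" "\<And>k. k \<in> {1..K} \<Longrightarrow> p k \<in> hypograph c (D k)"
      by (auto simp: set_sum_alt)
    then obtain x where x: "\<And>k. k \<in> {1..K} \<Longrightarrow>
        (x k, fst (p k)) \<in> sub_feasible c (D k) \<and> snd (p k) \<le> utility (D k) (x k)"
      unfolding hypograph_def mem_Collect_eq case_prod_beta by metis
    have "(\<Sum>k=1..K. fst (p k)) = c" "(\<Sum>k=1..K. snd (p k)) = ?q"
      using p(1) by (metis fst_conv fst_sum, metis snd_conv snd_sum)
    then have "?q \<le> (\<Sum>k=1..K. utility (D k) (x k))"
      using x sum_mono[of "{1..K}" "\<lambda>k. snd (p k)" "\<lambda>k. utility (D k) (x k)"] by simp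
    also have "\<dots> \<le> ?p"
      using x \<open>(\<Sum>k=1..K. fst (p k)) = c\<close> by (intro best[where s = "\<lambda>k. fst (p k)"]) auto
    finally show False using less by simp
  qed
  ultimately obtain y b where sep: "y \<bullet> (c, ?q) < b" "\<And>z. z \<in> ?H \<Longrightarrow> b < y \<bullet> z"
    using separating_hyperplane_closed_point[of ?H "(c, ?q)"] by blast
  obtain a \<beta> where y: "y = (a, \<beta>)" by (cases y)
  have memH: "((\<Sum>k=1..K. s k), (\<Sum>k=1..K. utility (D k) (x k))) \<in> ?H"
    if "\<And>k. k \<in> {1..K} \<Longrightarrow> (x k, s k) \<in> sub_feasible c (D k)" for x s
  proof -
    have "((\<Sum>k=1..K. s k), (\<Sum>k=1..K. utility (D k) (x k))) = (\<Sum>k=1..K. (s k, utility (D k) (x k)))"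
      by (simp add: prod_eq_iff fst_sum snd_sum)
    then show ?thesis
      using that unfolding set_sum_alt[OF finite_atLeastAtMost]
      by (intro CollectI exI[of _ "\<lambda>k. (s k, utility (D k) (x k))"]) (force simp: hypograph_def)
  qed
  have "(c, ?p) \<in> ?H"
    using memH[of xs ss] primal by (auto simp: rs_optimal_def is_arg_max_def)
  then have "\<beta> * (?q - ?p) < 0"
    using sep by (force simp: y algebra_simps)
  then have neg: "\<beta> < 0"
    using less by (simp add: mult_less_0_iff)
  \<comment> \<open>The multiplier read off from the hyperplane after its normal is scaled to last coordinate
  \<open>-1\<close>.\<close>
  define l where "l = (- 1 / \<beta>) *\<^sub>R a"
  obtain z where z: "\<And>k. k \<in> {1..K} \<Longrightarrow> sub_optimal c (D k) l (z k)"
    using bchoice[of "{1..K}" "\<lambda>k. sub_optimal c (D k) l"] opt by blast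
  have "(\<Sum>k=1..K. sub_value c (D k) l) = (\<Sum>k=1..K. utility (D k) (fst (z k)) - snd (z k) \<bullet> l)"
  proof (intro sum.cong refl)
    show "sub_value c (D k) l = utility (D k) (fst (z k)) - snd (z k) \<bullet> l" if "k \<in> {1..K}" for k
      using sub_value_eq[OF z[OF that]] by (simp add: sub_objective_def case_prod_beta)
  qed
  then have "dual_fun K c D l =
      c \<bullet> l + (\<Sum>k=1..K. utility (D k) (fst (z k))) - (\<Sum>k=1..K. snd (z k)) \<bullet> l"
    by (simp add: dual_fun_def sum_subtractf inner_sum_left)
  also have "\<dots> = (a \<bullet> (\<Sum>k=1..K. snd (z k)) + \<beta> * (\<Sum>k=1..K. utility (D k) (fst (z k))) - a \<bullet> c) / \<beta>"
    using neg by (simp add: l_def field_simps inner_commute)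
  also have "\<dots> < ?q"
  proof -
    have "b < y \<bullet> (\<Sum>k=1..K. snd (z k), \<Sum>k=1..K. utility (D k) (fst (z k)))"
      using z by (intro sep(2) memH) (simp add: sub_optimal_def is_arg_max_def)
    then show ?thesis
      using sep(1) neg by (simp add: y field_simps)
  qed
  also have "?q \<le> dual_fun K c D l"
    using dual by (simp add: dual_optimal_def dual_fun_def is_arg_min_linorder)
  finally show False by simp
qed

section \<open>The heavy-ball recursion\<close>

text \<open>
  The shifted points \<open>z t\<close> perform plain gradient steps of size \<open>\<nu> / (1 - \<gamma>)\<close> along \<open>h t\<close>: the
  shift absorbs the momentum term. Expanding the squared distance of \<open>z t\<close> to \<open>y\<close> and
  telescoping gives the bound. At time \<open>0\<close> the previous index \<open>t - 1\<close> is \<open>0\<close> as well, which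
  encodes the start without momentum and gives \<open>z 0 = l 0\<close>.
\<close>

lemma heavy_ball_energy:
  fixes l h :: "nat \<Rightarrow> 'a::real_inner" and \<gamma> \<nu> :: real
  assumes "\<gamma> < 1" and rec: "\<And>t. t < T \<Longrightarrow> l (Suc t) = l t - \<nu> *\<^sub>R h t + \<gamma> *\<^sub>R (l t - l (t - 1))"
  defines "z \<equiv> \<lambda>t. l t + (\<gamma> / (1 - \<gamma>)) *\<^sub>R (l t - l (t - 1))"
  shows "2 * \<nu> / (1 - \<gamma>) * (\<Sum>t<T. h t \<bullet> (z t - y))
    \<le> (norm (l 0 - y))\<^sup>2 + (\<nu> / (1 - \<gamma>))\<^sup>2 * (\<Sum>t<T. (norm (h t))\<^sup>2)"
proof -
  define \<eta> where "\<eta> = \<nu> / (1 - \<gamma>)"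
  have z_Suc: "z (Suc t) = z t - \<eta> *\<^sub>R h t" if "t < T" for t
  proof -
    have c: "1 / (1 - \<gamma>) = 1 + \<gamma> / (1 - \<gamma>)"
      using \<open>\<gamma> < 1\<close> by (simp add: field_simps)
    have "z (Suc t) = l t + (1 / (1 - \<gamma>)) *\<^sub>R (l (Suc t) - l t)"
      unfolding c by (simp add: z_def algebra_simps)
    also have "\<dots> = l t - \<eta> *\<^sub>R h t + (\<gamma> / (1 - \<gamma>)) *\<^sub>R (l t - l (t - 1))"
      by (simp add: rec[OF that] \<eta>_def algebra_simps)
    finally show ?thesis by (simp add: z_def)
  qed
  have "(norm (z t - y))\<^sup>2 = (norm (l 0 - y))\<^sup>2
      - 2 * \<eta> * (\<Sum>t<t. h t \<bullet> (z t - y)) + \<eta>\<^sup>2 * (\<Sum>t<t. (norm (h t))\<^sup>2)" if "t \<le> T" for t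
    using that
  proof (induction t)
    case 0
    show ?case by (simp add: z_def)
  next
    case (Suc t)
    have square: "(norm (u - \<eta> *\<^sub>R w))\<^sup>2 = (norm u)\<^sup>2 - 2 * \<eta> * (w \<bullet> u) + \<eta>\<^sup>2 * (norm w)\<^sup>2"
      for u w :: 'a
      by (simp add: power2_norm_eq_inner inner_diff_left inner_diff_right inner_commute)
        (simp add: power2_eq_square algebra_simps)
    have "z (Suc t) - y = (z t - y) - \<eta> *\<^sub>R h t"
      using z_Suc Suc.prems by simp
    then have "(norm (z (Suc t) - y))\<^sup>2 =
        (norm (z t - y))\<^sup>2 - 2 * \<eta> * (h t \<bullet> (z t - y)) + \<eta>\<^sup>2 * (norm (h t))\<^sup>2"
      by (simp only: square)
    with Suc show ?case by (simp add: algebra_simps)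
  qed
  from this[of T] have "2 * \<eta> * (\<Sum>t<T. h t \<bullet> (z t - y))
      \<le> (norm (l 0 - y))\<^sup>2 + \<eta>\<^sup>2 * (\<Sum>t<T. (norm (h t))\<^sup>2)"
    using zero_le_power2[of "norm (z T - y)"] by linarith
  then show ?thesis by (simp add: \<eta>_def)
qed

section \<open>Independence from generated sigma-algebras\<close>

text \<open>
  The sigma-algebra generated by the variables \<open>X i\<close> with \<open>i\<close> in \<open>A\<close>. For the noise coordinates
  drawn before time \<open>t\<close> this is the natural filtration, and measurability of the iterates then
  follows from the closure properties of measurable functions.
\<close>

definition generated :: "'a measure \<Rightarrow> ('i \<Rightarrow> 'a \<Rightarrow> real) \<Rightarrow> 'i set \<Rightarrow> 'a measure" where
  "generated P X A = vimage_algebra (space P) (\<lambda>a. \<lambda>i\<in>A. X i a) (Pi\<^sub>M A (\<lambda>_. borel))"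

lemma measurable_generated_coord:
  assumes "i \<in> A"
  shows "X i \<in> borel_measurable (generated P X A)"
proof -
  have "(\<lambda>a. \<lambda>i\<in>A. X i a) \<in> generated P X A \<rightarrow>\<^sub>M Pi\<^sub>M A (\<lambda>_. borel)"
    unfolding generated_def by (rule measurable_vimage_algebra1) (simp add: space_PiM)
  from measurable_compose[OF this measurable_component_singleton[OF assms]]
  show ?thesis using assms by simp
qed

context prob_space
begin

lemma measurable_generated_imp_random_variable:
  assumes "\<And>i. i \<in> A \<Longrightarrow> random_variable borel (X i)" and "Y \<in> borel_measurable (generated M X A)"
  shows "random_variable borel Y"
proof -
  have "(\<lambda>a. \<lambda>i\<in>A. X i a) \<in> M \<rightarrow>\<^sub>M Pi\<^sub>M A (\<lambda>_. borel)"
    using assms(1) by (intro measurable_restrict) auto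
  then have "id \<in> M \<rightarrow>\<^sub>M generated M X A"
    unfolding generated_def by (intro measurable_vimage_algebra2) auto
  from measurable_comp[OF this assms(2)] show ?thesis by simp
qed

text \<open>
  Preimages under \<open>Y\<close> and \<open>Z\<close> lie in the sigma-algebras generated by the restrictions of the family
  to \<open>A\<close> and \<open>B\<close>, and these restrictions are independent because \<open>A\<close> and \<open>B\<close> are disjoint.
\<close>

lemma indep_var_generated:
  fixes Y Z :: "'a \<Rightarrow> real"
  assumes ind: "indep_vars (\<lambda>_. borel) X I" and AB: "A \<inter> B = {}" "A \<subseteq> I" "B \<subseteq> I"
    and Y: "Y \<in> borel_measurable (generated M X A)" and Z: "Z \<in> borel_measurable (generated M X B)"
  shows "indep_var borel Y borel Z"
proof -
  let ?gen = "\<lambda>A. sigma_sets (space M)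
    {(\<lambda>a. \<lambda>i\<in>A. X i a) -` S \<inter> space M |S. S \<in> sets (PiM A (\<lambda>_. borel))}"
  have rv: "random_variable borel (X j)" if "j \<in> I" for j
    using ind that by (auto simp: indep_vars_def)
  have "indep_var (PiM A (\<lambda>_. borel)) (\<lambda>a. \<lambda>i\<in>A. X i a) (PiM B (\<lambda>_. borel)) (\<lambda>a. \<lambda>i\<in>B. X i a)"
    by (rule indep_var_restrict[OF ind AB])
  then have indep: "indep_set (?gen A) (?gen B)"
    by (simp add: indep_var_eq)
  have sub: "sigma_sets (space M) {W -` S \<inter> space M |S. S \<in> sets borel} \<subseteq> ?gen C"
    if "W \<in> borel_measurable (generated M X C)" for W :: "'a \<Rightarrow> real" and C
  proof (rule sigma_sets_mono)
    show "{W -` S \<inter> space M |S. S \<in> sets borel} \<subseteq> ?gen C"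
      using measurable_sets[OF that] by (auto simp: generated_def sets_vimage_algebra)
  qed
  have "indep_set (sigma_sets (space M) {Y -` S \<inter> space M |S. S \<in> sets borel})
      (sigma_sets (space M) {Z -` S \<inter> space M |S. S \<in> sets borel})"
    using indep sub[OF Y] sub[OF Z] unfolding indep_set_def
    by (elim indep_sets_mono_sets) (auto split: bool.split)
  moreover have "random_variable borel Y" "random_variable borel Z"
    using rv AB by (auto intro!: measurable_generated_imp_random_variable[OF _ Y]
        measurable_generated_imp_random_variable[OF _ Z])
  ultimately show ?thesis
    by (simp add: indep_var_eq)
qed

end

section \<open>Expected regret under independent noise\<close>

lemma borel_measurable_vecI:
  fixes f :: "'a \<Rightarrow> real^'m::finite"
  assumes "\<And>j. (\<lambda>a. f a $ j) \<in> borel_measurable M"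
  shows "f \<in> borel_measurable M"
  using assms by (subst borel_measurable_euclidean_space) (auto simp: Basis_vec_def inner_axis)

lemma integrable_vecI:
  fixes f :: "'a \<Rightarrow> real^'m::finite"
  assumes "\<And>j. integrable M (\<lambda>a. f a $ j)"
  shows "integrable M f"
proof -
  have "integrable M (\<lambda>a. \<Sum>j\<in>UNIV. f a $ j *\<^sub>R axis j (1::real))"
    using assms by (intro Bochner_Integration.integrable_sum integrable_scaleR_left) auto
  moreover have "(\<Sum>j\<in>UNIV. f a $ j *\<^sub>R axis j (1::real)) = f a" for a
    using basis_expansion[of "f a"] by (simp only: scalar_mult_eq_scaleR)
  ultimately show ?thesis
    by simp
qed

lemma integrable_vec_nth:
  fixes f :: "'a \<Rightarrow> real^'m::finite"
  assumes "integrable M f"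
  shows "integrable M (\<lambda>a. f a $ j)"
  using assms by (rule integrable_bounded_linear[OF bounded_linear_vec_nth])

text \<open>
  The resource-sharing problem enters the convergence argument only through a bounded subgradient
  oracle \<open>g\<close> of its dual function \<open>f\<close>, and the Gaussian law of the noise only through its first
  two moments, so the argument is carried out at that generality.
\<close>

locale noisy_heavy_ball = prob_space P for P :: "'a measure" +
  fixes f :: "real^'m::finite \<Rightarrow> real" and g :: "real^'m \<Rightarrow> real^'m"
    and \<omega> :: "nat \<Rightarrow> nat \<Rightarrow> 'a \<Rightarrow> real^'m" and l :: "nat \<Rightarrow> 'a \<Rightarrow> real^'m"
    and K T :: nat and \<gamma> \<nu> R :: real and v :: "'m \<Rightarrow> real"
  assumes subgradient: "\<And>x y. f x - f y \<le> g x \<bullet> (x - y)"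
    and measurable_g: "g \<in> borel_measurable borel"
    and norm_g: "\<And>x. norm (g x) \<le> R"
    and indep: "indep_vars (\<lambda>_. borel) (\<lambda>(k, j, t) a. \<omega> k t a $ j) ({1..K} \<times> UNIV \<times> {..<T})"
    and noise_integrable: "\<And>k j t. k \<in> {1..K} \<Longrightarrow> t < T \<Longrightarrow> integrable P (\<lambda>a. \<omega> k t a $ j)"
    and noise_mean: "\<And>k j t. k \<in> {1..K} \<Longrightarrow> t < T \<Longrightarrow> expectation (\<lambda>a. \<omega> k t a $ j) = 0"
    and noise_square_integrable:
      "\<And>k j t. k \<in> {1..K} \<Longrightarrow> t < T \<Longrightarrow> integrable P (\<lambda>a. (\<omega> k t a $ j)\<^sup>2)"
    and noise_variance: "\<And>k j t. k \<in> {1..K} \<Longrightarrow> t < T \<Longrightarrow> expectation (\<lambda>a. (\<omega> k t a $ j)\<^sup>2) = v j"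
    and start: "\<And>a. l 0 a = 0"
    and update: "\<And>t a. l (Suc t) a =
      l t a - \<nu> *\<^sub>R (g (l t a) - (\<Sum>k=1..K. \<omega> k t a)) + \<gamma> *\<^sub>R (l t a - l (t - 1) a)"
begin

text \<open>
  One family for all noise coordinates, so that independence results for indexed families apply.
\<close>

definition coord :: "nat \<times> 'm \<times> nat \<Rightarrow> 'a \<Rightarrow> real" where
  "coord = (\<lambda>(k, j, t) a. \<omega> k t a $ j)"

definition indices :: "nat \<Rightarrow> (nat \<times> 'm \<times> nat) set" where
  "indices t = {1..K} \<times> UNIV \<times> {..<t}"

definition noise :: "nat \<Rightarrow> 'a \<Rightarrow> real^'m" where
  "noise t a = (\<Sum>k=1..K. \<omega> k t a)"

lemma coord_simp: "coord (k, j, t) = (\<lambda>a. \<omega> k t a $ j)"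
  by (simp add: coord_def)

lemma indep_coord: "indep_vars (\<lambda>_. borel) coord (indices T)"
  using indep by (simp add: coord_def indices_def)

lemma random_variable_coord: "i \<in> indices T \<Longrightarrow> random_variable borel (coord i)"
  using indep_coord by (auto simp: indep_vars_def)

lemma R_nonneg: "0 \<le> R"
  using norm_g[of 0] norm_ge_zero order_trans by blast

lemma measurable_iterate_past: "t \<le> n \<Longrightarrow> l t \<in> borel_measurable (generated P coord (indices n))"
proof (induction t rule: less_induct)
  case (less t)
  show ?case
  proof (cases t)
    case 0
    then show ?thesis by (simp add: start)
  next
    case (Suc s)
    have [measurable]: "(\<lambda>a. \<omega> k s a) \<in> borel_measurable (generated P coord (indices n))"
      if "k \<in> {1..K}" for k
    proof (rule borel_measurable_vecI)
      fix j
      show "(\<lambda>a. \<omega> k s a $ j) \<in> borel_measurable (generated P coord (indices n))"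
        using measurable_generated_coord[of "(k, j, s)" "indices n" coord P] that less.prems Suc
        by (simp add: coord_simp indices_def)
    qed
    have [measurable]: "l s \<in> borel_measurable (generated P coord (indices n))"
        "l (s - 1) \<in> borel_measurable (generated P coord (indices n))"
      using less Suc by auto
    note [measurable] = measurable_g
    have "(\<lambda>a. l s a - \<nu> *\<^sub>R (g (l s a) - (\<Sum>k=1..K. \<omega> k s a)) + \<gamma> *\<^sub>R (l s a - l (s - 1) a))
        \<in> borel_measurable (generated P coord (indices n))"
      by measurable
    then show ?thesis
      unfolding Suc update[abs_def] .
  qed
qed

lemma measurable_iterate: "t \<le> T \<Longrightarrow> random_variable borel (l t)"
  using measurable_generated_imp_random_variable[OF random_variable_coord measurable_iterate_past] by blast

lemma measurable_subgradient: "t \<le> T \<Longrightarrow> random_variable borel (\<lambda>a. g (l t a))"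
  using measurable_compose[OF measurable_iterate measurable_g] .

lemma integrable_noise: "t < T \<Longrightarrow> integrable P (noise t)"
  unfolding noise_def
  by (intro Bochner_Integration.integrable_sum integrable_vecI noise_integrable)

lemma integrable_subgradient: "t \<le> T \<Longrightarrow> integrable P (\<lambda>a. g (l t a))"
  by (rule integrable_const_bound[of _ R]) (auto simp: norm_g measurable_subgradient)

lemma integrable_iterate: "t \<le> T \<Longrightarrow> integrable P (l t)"
proof (induction t rule: less_induct)
  case (less t)
  show ?case
  proof (cases t)
    case 0
    then show ?thesis by (simp add: start[abs_def])
  next
    case (Suc s)
    have "integrable P (\<lambda>a. l s a - \<nu> *\<^sub>R (g (l s a) - noise s a) + \<gamma> *\<^sub>R (l s a - l (s - 1) a))"
      using less Suc integrable_noise[of s] integrable_subgradient[of s] by auto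
    then show ?thesis
      unfolding Suc noise_def update[abs_def] .
  qed
qed

text \<open>
  Expanding the inner product into coordinates leaves products of two independent integrable
  variables, one of which is centred.
\<close>

lemma noise_orthogonal_to_past:
  assumes t: "t < T" and Y: "Y \<in> borel_measurable (generated P coord (indices t))" "integrable P Y"
  shows "integrable P (\<lambda>a. noise t a \<bullet> Y a)" and "expectation (\<lambda>a. noise t a \<bullet> Y a) = 0"
proof -
  have coordinate: "integrable P (\<lambda>a. \<omega> k t a $ j * Y a $ j)"
      "expectation (\<lambda>a. \<omega> k t a $ j * Y a $ j) = 0" if k: "k \<in> {1..K}" for k j
  proof -
    have "(\<lambda>a. Y a $ j) \<in> borel_measurable (generated P coord (indices t))"
      using Y(1) by (simp add: cart_eq_inner_axis)
    then have ind: "indep_var borel (\<lambda>a. Y a $ j) borel (\<lambda>a. \<omega> k t a $ j)"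
      using measurable_generated_coord[of "(k, j, t)" "{(k, j, t)}" coord P] t k
      by (intro indep_var_generated[OF indep_coord, of "indices t" "{(k, j, t)}"])
        (auto simp: indices_def coord_simp)
    show "integrable P (\<lambda>a. \<omega> k t a $ j * Y a $ j)"
      using indep_var_integrable[OF ind integrable_vec_nth[OF Y(2)] noise_integrable[OF k t]]
      by (simp add: mult.commute)
    show "expectation (\<lambda>a. \<omega> k t a $ j * Y a $ j) = 0"
      using indep_var_lebesgue_integral[OF ind integrable_vec_nth[OF Y(2)] noise_integrable[OF k t]]
      by (simp add: mult.commute noise_mean[OF k t])
  qed
  have eq: "noise t a \<bullet> Y a = (\<Sum>j\<in>UNIV. \<Sum>k=1..K. \<omega> k t a $ j * Y a $ j)" for a
    by (simp add: noise_def inner_vec_def sum_distrib_right)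
  show "integrable P (\<lambda>a. noise t a \<bullet> Y a)"
    unfolding eq using coordinate by (intro Bochner_Integration.integrable_sum) auto
  show "expectation (\<lambda>a. noise t a \<bullet> Y a) = 0"
    unfolding eq using coordinate
    by (subst Bochner_Integration.integral_sum;
        (intro Bochner_Integration.integrable_sum sum.neutral ballI)?)
      (auto simp: Bochner_Integration.integral_sum)
qed

lemma noise_second_moment:
  assumes t: "t < T"
  shows "integrable P (\<lambda>a. (norm (noise t a))\<^sup>2)"
    and "expectation (\<lambda>a. (norm (noise t a))\<^sup>2) = real K * (\<Sum>j\<in>UNIV. v j)"
proof -
  have cross: "integrable P (\<lambda>a. \<omega> k t a $ j * \<omega> k' t a $ j) \<and>
      expectation (\<lambda>a. \<omega> k t a $ j * \<omega> k' t a $ j) = (if k' = k then v j else 0)"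
    if k: "k \<in> {1..K}" "k' \<in> {1..K}" for k k' j
  proof (cases "k' = k")
    case True
    then show ?thesis
      using noise_square_integrable[OF k(1) t, of j] noise_variance[OF k(1) t, of j]
      by (simp add: power2_eq_square)
  next
    case False
    have "(\<lambda>a. \<omega> k t a $ j) \<in> borel_measurable (generated P coord {(k, j, t)})" for k
      using measurable_generated_coord[of "(k, j, t)" "{(k, j, t)}" coord P] by (simp add: coord_simp)
    then have ind: "indep_var borel (\<lambda>a. \<omega> k t a $ j) borel (\<lambda>a. \<omega> k' t a $ j)"
      using t k False by (intro indep_var_generated[OF indep_coord, of "{(k, j, t)}" "{(k', j, t)}"])
        (auto simp: indices_def)
    show ?thesis
      using indep_var_integrable[OF ind noise_integrable[OF k(1) t] noise_integrable[OF k(2) t]]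
        indep_var_lebesgue_integral[OF ind noise_integrable[OF k(1) t] noise_integrable[OF k(2) t]]
        False noise_mean[OF k(1) t, of j]
      by simp
  qed
  have eq: "(norm (noise t a))\<^sup>2 = (\<Sum>j\<in>UNIV. \<Sum>k=1..K. \<Sum>k'=1..K. \<omega> k t a $ j * \<omega> k' t a $ j)" for a
    by (simp add: power2_norm_eq_inner noise_def inner_vec_def sum_product)
  have int_k: "integrable P (\<lambda>a. \<Sum>k'=1..K. \<omega> k t a $ j * \<omega> k' t a $ j)" if "k \<in> {1..K}" for k j
    using cross that by (intro Bochner_Integration.integrable_sum) auto
  have int_j: "integrable P (\<lambda>a. \<Sum>k=1..K. \<Sum>k'=1..K. \<omega> k t a $ j * \<omega> k' t a $ j)" for j
    using int_k by (rule Bochner_Integration.integrable_sum)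
  show "integrable P (\<lambda>a. (norm (noise t a))\<^sup>2)"
    unfolding eq using int_j by (rule Bochner_Integration.integrable_sum)
  have "expectation (\<lambda>a. (norm (noise t a))\<^sup>2) =
      (\<Sum>j\<in>UNIV. expectation (\<lambda>a. \<Sum>k=1..K. \<Sum>k'=1..K. \<omega> k t a $ j * \<omega> k' t a $ j))"
    unfolding eq using int_j by (rule Bochner_Integration.integral_sum)
  also have "\<dots> = (\<Sum>j\<in>UNIV. \<Sum>k=1..K. expectation (\<lambda>a. \<Sum>k'=1..K. \<omega> k t a $ j * \<omega> k' t a $ j))"
    using int_k by (intro sum.cong refl Bochner_Integration.integral_sum) auto
  also have "\<dots> = (\<Sum>j\<in>UNIV. \<Sum>k=1..K. \<Sum>k'=1..K. if k' = k then v j else 0)"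
    using cross by (intro sum.cong refl) (simp add: Bochner_Integration.integral_sum)
  also have "\<dots> = real K * (\<Sum>j\<in>UNIV. v j)"
    by (simp add: sum_distrib_left)
  finally show "expectation (\<lambda>a. (norm (noise t a))\<^sup>2) = real K * (\<Sum>j\<in>UNIV. v j)" .
qed

text \<open>
  Bounded subgradients make \<open>f\<close> Lipschitz, hence measurable along the iterates, and integrability
  of the iterates passes on to the values of \<open>f\<close>.
\<close>

lemma f_lipschitz: "\<bar>f x - f y\<bar> \<le> R * norm (x - y)"
proof -
  have "f x - f y \<le> R * norm (x - y)" for x y
    by (meson subgradient norm_g norm_cauchy_schwarz mult_right_mono norm_ge_zero order_trans)
  from this[of x y] this[of y x] show ?thesis
    by (simp add: norm_minus_commute abs_le_iff)
qed

lemma integrable_f_iterate: "t \<le> T \<Longrightarrow> integrable P (\<lambda>a. f (l t a))"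
proof -
  assume t: "t \<le> T"
  have "R-lipschitz_on UNIV f"
    using f_lipschitz R_nonneg by (intro lipschitz_onI) (auto simp: dist_norm)
  then have "f \<in> borel_measurable borel"
    by (intro borel_measurable_continuous_onI lipschitz_on_continuous_on)
  from measurable_compose[OF measurable_iterate[OF t] this]
  have meas: "(\<lambda>a. f (l t a)) \<in> borel_measurable P" .
  have bound: "norm (f (l t a)) \<le> norm (\<bar>f 0\<bar> + R * norm (l t a))" for a
    using f_lipschitz[of "l t a" 0] R_nonneg by simp
  show ?thesis
    by (rule Bochner_Integration.integrable_bound[OF _ meas AE_I2[OF bound]])
      (use integrable_iterate[OF t] in auto)
qed

text \<open>
  Take expectations in the energy estimate for the noisy directions \<open>h t\<close>. The noise at time \<open>t\<close>
  is orthogonal to the past, so in the linear terms \<open>h t\<close> may be replaced by the exact subgradient,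
  and the squared norms split into \<open>R\<^sup>2\<close> plus the noise variance. The shifted point minus \<open>y\<close> is
  \<open>(l t - y) + \<mu> (l t - l (t - 1))\<close> with \<open>\<mu> = \<gamma> / (1 - \<gamma>)\<close>; the subgradient inequality turns its
  two parts into the gap \<open>e t\<close> and into \<open>\<mu>\<close> times the increment of the gap, and the increments
  telescope.
\<close>

theorem expected_regret:
  fixes y
  assumes \<gamma>: "0 \<le> \<gamma>" "\<gamma> < 1" and \<nu>: "0 < \<nu>" and "0 < T"
  defines "e \<equiv> \<lambda>t. expectation (\<lambda>a. f (l t a)) - f y"
  shows "2 * \<nu> / (1 - \<gamma>) * ((\<Sum>t<T. e t) + \<gamma> / (1 - \<gamma>) * (e (T - 1) - e 0))
    \<le> (norm y)\<^sup>2 + (\<nu> / (1 - \<gamma>))\<^sup>2 * (real T * (R\<^sup>2 + real K * (\<Sum>j\<in>UNIV. v j)))"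
proof -
  define \<mu> where "\<mu> = \<gamma> / (1 - \<gamma>)"
  have \<mu>: "0 \<le> \<mu>" using \<gamma> by (simp add: \<mu>_def)
  define z where "z t a = l t a + \<mu> *\<^sub>R (l t a - l (t - 1) a)" for t a
  define h where "h t a = g (l t a) - noise t a" for t a
  have energy: "2 * \<nu> / (1 - \<gamma>) * (\<Sum>t<T. h t a \<bullet> (z t a - y))
      \<le> (norm y)\<^sup>2 + (\<nu> / (1 - \<gamma>))\<^sup>2 * (\<Sum>t<T. (norm (h t a))\<^sup>2)" for a
    using heavy_ball_energy[of \<gamma> T "\<lambda>t. l t a" \<nu> "\<lambda>t. h t a" y] \<gamma>
    by (simp add: update h_def z_def \<mu>_def noise_def start)
  have z_past: "(\<lambda>a. z t a - y) \<in> borel_measurable (generated P coord (indices t))" for t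
    unfolding z_def using measurable_iterate_past[of t t] measurable_iterate_past[of "t - 1" t]
    by simp
  have z_int: "integrable P (\<lambda>a. z t a - y)" if "t \<le> T" for t
    unfolding z_def using integrable_iterate[of t] integrable_iterate[of "t - 1"] that by auto
  have gz_int: "integrable P (\<lambda>a. g (l t a) \<bullet> (z t a - y))" if "t \<le> T" for t
  proof (rule Bochner_Integration.integrable_bound)
    show "integrable P (\<lambda>a. R * norm (z t a - y))"
      using z_int[OF that] by auto
    show "(\<lambda>a. g (l t a) \<bullet> (z t a - y)) \<in> borel_measurable P"
      using measurable_subgradient[OF that] borel_measurable_integrable[OF z_int[OF that]] by simp
    show "AE a in P. norm (g (l t a) \<bullet> (z t a - y)) \<le> norm (R * norm (z t a - y))"
      using R_nonneg norm_g
      by (intro AE_I2) (auto intro!: order_trans[OF Cauchy_Schwarz_ineq2] mult_right_mono)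
  qed
  have first: "integrable P (\<lambda>a. h t a \<bullet> (z t a - y)) \<and>
      e t + \<mu> * (e t - e (t - 1)) \<le> expectation (\<lambda>a. h t a \<bullet> (z t a - y))" if t: "t < T" for t
  proof -
    have t': "t \<le> T" "t - 1 \<le> T" using t by auto
    note noise = noise_orthogonal_to_past[OF t z_past z_int[OF t'(1)]]
    have eq: "h t a \<bullet> (z t a - y) = g (l t a) \<bullet> (z t a - y) - noise t a \<bullet> (z t a - y)" for a
      by (simp add: h_def inner_diff_left)
    have "e t + \<mu> * (e t - e (t - 1)) =
        expectation (\<lambda>a. (f (l t a) - f y) + \<mu> * (f (l t a) - f (l (t - 1) a)))"
      using integrable_f_iterate[OF t'(1)] integrable_f_iterate[OF t'(2)]
      by (simp add: e_def prob_space)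
    also have "\<dots> \<le> expectation (\<lambda>a. g (l t a) \<bullet> (z t a - y))"
    proof (rule integral_mono)
      show "(f (l t a) - f y) + \<mu> * (f (l t a) - f (l (t - 1) a)) \<le> g (l t a) \<bullet> (z t a - y)" for a
      proof -
        have "g (l t a) \<bullet> (z t a - y) =
            g (l t a) \<bullet> (l t a - y) + \<mu> * (g (l t a) \<bullet> (l t a - l (t - 1) a))"
          by (simp add: z_def inner_add_right inner_diff_right algebra_simps)
        then show ?thesis
          using subgradient[of "l t a" y] mult_left_mono[OF subgradient \<mu>] by (simp add: add_mono)
      qed
    qed (use integrable_f_iterate[OF t'(1)] integrable_f_iterate[OF t'(2)] gz_int[OF t'(1)] in auto)
    finally show ?thesis
      unfolding eq using noise gz_int[OF t'(1)] by simp
  qed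
  have second: "integrable P (\<lambda>a. (norm (h t a))\<^sup>2) \<and>
      expectation (\<lambda>a. (norm (h t a))\<^sup>2) \<le> R\<^sup>2 + real K * (\<Sum>j\<in>UNIV. v j)" if t: "t < T" for t
  proof -
    have t': "t \<le> T" using t by auto
    have g_past: "(\<lambda>a. g (l t a)) \<in> borel_measurable (generated P coord (indices t))"
      using measurable_compose[OF measurable_iterate_past measurable_g] by simp
    note noise = noise_orthogonal_to_past[OF t g_past integrable_subgradient[OF t']]
      noise_second_moment[OF t]
    have eq: "(norm (h t a))\<^sup>2 =
        (norm (g (l t a)))\<^sup>2 - 2 * (noise t a \<bullet> g (l t a)) + (norm (noise t a))\<^sup>2" for a
      by (simp add: h_def power2_norm_eq_inner inner_diff_left inner_diff_right inner_commute)
    have sq: "(norm (g x))\<^sup>2 \<le> R\<^sup>2" for x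
      using norm_g by (simp add: power_mono)
    have gg: "integrable P (\<lambda>a. (norm (g (l t a)))\<^sup>2)"
      using sq measurable_subgradient[OF t'] by (intro integrable_const_bound[of _ "R\<^sup>2"]) auto
    have "expectation (\<lambda>a. (norm (g (l t a)))\<^sup>2) \<le> expectation (\<lambda>a. R\<^sup>2)"
      using sq gg by (intro integral_mono) auto
    then show ?thesis
      unfolding eq using noise gg by (simp add: prob_space)
  qed
  have "(\<Sum>t<n. e t + \<mu> * (e t - e (t - 1))) = (\<Sum>t<n. e t) + \<mu> * (e (n - 1) - e 0)" for n
    by (induction n) (auto simp: algebra_simps)
  then have "2 * \<nu> / (1 - \<gamma>) * ((\<Sum>t<T. e t) + \<mu> * (e (T - 1) - e 0)) =
      2 * \<nu> / (1 - \<gamma>) * (\<Sum>t<T. e t + \<mu> * (e t - e (t - 1)))"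
    by simp
  also have "\<dots> \<le> 2 * \<nu> / (1 - \<gamma>) * (\<Sum>t<T. expectation (\<lambda>a. h t a \<bullet> (z t a - y)))"
    using first \<gamma> \<nu> by (intro mult_left_mono sum_mono) auto
  also have "\<dots> = expectation (\<lambda>a. 2 * \<nu> / (1 - \<gamma>) * (\<Sum>t<T. h t a \<bullet> (z t a - y)))"
    using first by (simp add: Bochner_Integration.integral_sum)
  also have "\<dots> \<le> expectation (\<lambda>a. (norm y)\<^sup>2 + (\<nu> / (1 - \<gamma>))\<^sup>2 * (\<Sum>t<T. (norm (h t a))\<^sup>2))"
  proof (rule integral_mono[OF _ _ energy])
    show "integrable P (\<lambda>a. 2 * \<nu> / (1 - \<gamma>) * (\<Sum>t<T. h t a \<bullet> (z t a - y)))"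
      using first by (intro integrable_mult_right Bochner_Integration.integrable_sum) simp
    show "integrable P (\<lambda>a. (norm y)\<^sup>2 + (\<nu> / (1 - \<gamma>))\<^sup>2 * (\<Sum>t<T. (norm (h t a))\<^sup>2))"
      using second
      by (intro Bochner_Integration.integrable_add integrable_const integrable_mult_right
          Bochner_Integration.integrable_sum) simp
  qed
  also have "\<dots> = (norm y)\<^sup>2 + (\<nu> / (1 - \<gamma>))\<^sup>2 * (\<Sum>t<T. expectation (\<lambda>a. (norm (h t a))\<^sup>2))"
  proof -
    have "integrable P (\<lambda>a. \<Sum>t<T. (norm (h t a))\<^sup>2)"
      using second by (intro Bochner_Integration.integrable_sum) simp
    then show ?thesis
      using second by (simp add: Bochner_Integration.integral_sum prob_space)
  qed
  also have "\<dots> \<le> (norm y)\<^sup>2 +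
      (\<nu> / (1 - \<gamma>))\<^sup>2 * (\<Sum>t<T. R\<^sup>2 + real K * (\<Sum>j\<in>UNIV. v j))"
    using second by (intro add_left_mono mult_left_mono sum_mono) auto
  finally show ?thesis by (simp add: \<mu>_def)
qed

end

section \<open>Moments of the noise\<close>

lemma integrable_return_borel:
  fixes f :: "real \<Rightarrow> real"
  assumes "f \<in> borel_measurable borel"
  shows "integrable (return borel x) f"
proof -
  interpret prob_space "return borel x" by (rule prob_space_return) simp
  have "AE y in return borel x. norm (f y) \<le> norm (f x)"
    using assms by (subst AE_return) auto
  then show ?thesis
    using assms by (intro integrable_const_bound[of _ "norm (f x)"]) auto
qed

lemma normal_law_moments:
  assumes "0 \<le> v"
  shows "integrable (normal_law 0 v) (\<lambda>x. x)" "(\<integral>x. x \<partial>normal_law 0 v) = 0"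
    and "integrable (normal_law 0 v) (\<lambda>x. x\<^sup>2)" "(\<integral>x. x\<^sup>2 \<partial>normal_law 0 v) = v"
proof -
  have "integrable (normal_law 0 v) (\<lambda>x. x) \<and> (\<integral>x. x \<partial>normal_law 0 v) = 0 \<and>
      integrable (normal_law 0 v) (\<lambda>x. x\<^sup>2) \<and> (\<integral>x. x\<^sup>2 \<partial>normal_law 0 v) = v"
  proof (cases "v = 0")
    case True
    then show ?thesis
      by (simp add: normal_law_def integrable_return_borel integral_return)
  next
    case False
    then have pos: "0 < sqrt v"
      using assms by simp
    have "integrable lborel (\<lambda>x. normal_density 0 (sqrt v) x * x)"
      using integrable_normal_moment[OF pos, of 0 1] by simp
    moreover have "integrable lborel (\<lambda>x. normal_density 0 (sqrt v) x * x\<^sup>2)"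
      using integrable_normal_moment[OF pos, of 0 2] by simp
    moreover have "(\<integral>x. normal_density 0 (sqrt v) x * x \<partial>lborel) = 0"
      using integral_normal_moment_odd[OF pos, of 0 0] by simp
    moreover have "(\<integral>x. normal_density 0 (sqrt v) x * x\<^sup>2 \<partial>lborel) = v"
      using integral_normal_moment_even[OF pos, of 0 1] assms by simp
    ultimately show ?thesis
      using False
      by (simp add: normal_law_def integrable_density integral_density)
  qed
  then show "integrable (normal_law 0 v) (\<lambda>x. x)" "(\<integral>x. x \<partial>normal_law 0 v) = 0"
    "integrable (normal_law 0 v) (\<lambda>x. x\<^sup>2)" "(\<integral>x. x\<^sup>2 \<partial>normal_law 0 v) = v"
    by auto
qed

lemma moments_of_normal_law:
  assumes "0 \<le> v" and X: "X \<in> borel_measurable P" and law: "distr P borel X = normal_law 0 v"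
  shows "integrable P X" "(\<integral>a. X a \<partial>P) = 0" "integrable P (\<lambda>a. (X a)\<^sup>2)" "(\<integral>a. (X a)\<^sup>2 \<partial>P) = v"
  using normal_law_moments[OF \<open>0 \<le> v\<close>] unfolding law[symmetric]
  by (simp_all add: integrable_distr_eq[OF X] integral_distr[OF X])

section \<open>The dual function along the algorithm\<close>

definition dual_subgradient ::
  "nat \<Rightarrow> real^'m \<Rightarrow> (nat \<Rightarrow> real^'m \<Rightarrow> (nat \<Rightarrow> real) \<times> (real^'m)) \<Rightarrow> real^'m \<Rightarrow> real^'m::finite" where
  "dual_subgradient K c sel l = c - (\<Sum>k=1..K. snd (sel k l))"

lemma selection_optimal:
  assumes "argmax_selection K c D sel" "k \<in> {1..K}"
  shows "sub_optimal c (D k) l (sel k l)"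
    and "sel k l \<in> sub_feasible c (D k)"
    and "sub_value c (D k) l = utility (D k) (fst (sel k l)) - snd (sel k l) \<bullet> l"
proof -
  show opt: "sub_optimal c (D k) l (sel k l)"
    using assms by (simp add: argmax_selection_def)
  then show "sel k l \<in> sub_feasible c (D k)"
    by (simp add: sub_optimal_def is_arg_max_def)
  show "sub_value c (D k) l = utility (D k) (fst (sel k l)) - snd (sel k l) \<bullet> l"
    using sub_value_eq[OF opt] by (simp add: sub_objective_def case_prod_beta)
qed

lemma lagrangian_selection:
  assumes "argmax_selection K c D sel"
  shows "lagrangian K c D (\<lambda>k. fst (sel k l)) (\<lambda>k. snd (sel k l)) l = dual_fun K c D l"
  unfolding lagrangian_def dual_fun_def
  using selection_optimal(3)[OF assms] by (auto intro!: sum.cong)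

text \<open>
  A maximiser at \<open>x\<close> is still feasible at \<open>y\<close>, so its objective there is a lower bound for the
  value of the sub-problem.
\<close>

lemma dual_subgradient_inequality:
  assumes "argmax_selection K c D sel"
  shows "dual_fun K c D x - dual_fun K c D y \<le> dual_subgradient K c sel x \<bullet> (x - y)"
proof -
  have "sub_value c (D k) x - sub_value c (D k) y \<le> - (snd (sel k x) \<bullet> (x - y))"
    if k: "k \<in> {1..K}" for k
  proof -
    have "sub_objective (D k) y (sel k x) \<le> sub_value c (D k) y"
      by (rule sub_objective_le_sub_value[OF exI]) (rule selection_optimal(1,2)[OF assms k])+
    then show ?thesis
      using selection_optimal(3)[OF assms k, of x]
      by (simp add: sub_objective_def case_prod_beta inner_diff_right)
  qed
  then have "(\<Sum>k=1..K. sub_value c (D k) x - sub_value c (D k) y)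
      \<le> (\<Sum>k=1..K. - (snd (sel k x) \<bullet> (x - y)))"
    by (rule sum_mono)
  then show ?thesis
    by (simp add: dual_fun_def dual_subgradient_def sum_subtractf sum_negf inner_diff_left
        inner_diff_right inner_sum_left)
qed

text \<open>
  Each coordinate of the subgradient lies between \<open>-(K - 1) c\<^sub>j\<close> and \<open>c\<^sub>j\<close>, and \<open>K - 1 \<ge> 1\<close> makes the
  lower end the larger in modulus.
\<close>

lemma norm_dual_subgradient_le:
  assumes sel: "argmax_selection K c D sel" and "1 < K" "0 \<le> c"
  shows "norm (dual_subgradient K c sel l) \<le> (real K - 1) * norm c"
proof -
  have "norm (dual_subgradient K c sel l $ j) \<le> norm (((real K - 1) *\<^sub>R c) $ j)" for j
  proof -
    have s: "0 \<le> snd (sel k l) $ j \<and> snd (sel k l) $ j \<le> c $ j" if "k \<in> {1..K}" for k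
      using selection_optimal(2)[OF sel that, of l]
      by (auto simp: sub_feasible_def less_eq_vec_def)
    have "0 \<le> (\<Sum>k=1..K. snd (sel k l) $ j)"
      using s by (intro sum_nonneg) auto
    moreover have "(\<Sum>k=1..K. snd (sel k l) $ j) \<le> real K * (c $ j)"
      using sum_mono[of "{1..K}" "\<lambda>k. snd (sel k l) $ j" "\<lambda>_. c $ j"] s by simp
    moreover have "c $ j \<le> (real K - 1) * (c $ j)" "0 \<le> c $ j"
      using assms mult_right_mono[of 1 "real K - 1" "c $ j"] by (auto simp: less_eq_vec_def)
    ultimately show ?thesis
      by (simp add: dual_subgradient_def algebra_simps abs_if)
  qed
  then have "norm (dual_subgradient K c sel l) \<le> norm ((real K - 1) *\<^sub>R c)"
    by (rule norm_le_componentwise_cart)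
  then show ?thesis
    using \<open>1 < K\<close> by simp
qed

lemma measurable_dual_subgradient:
  assumes "argmax_selection K c D sel"
  shows "dual_subgradient K c sel \<in> borel_measurable borel"
proof -
  have "(\<lambda>l. snd (sel k l)) \<in> borel_measurable borel" if "k \<in> {1..K}" for k
  proof -
    have "sel k \<in> borel \<rightarrow>\<^sub>M (Pi\<^sub>M {..<n_vars (D k)} (\<lambda>_. borel)) \<Otimes>\<^sub>M borel"
      using assms that by (simp add: argmax_selection_def)
    from measurable_compose[OF this measurable_snd] show ?thesis .
  qed
  then show ?thesis
    unfolding dual_subgradient_def[abs_def] by (intro borel_measurable_diff borel_measurable_sum) auto
qed

text \<open>
  At its own multiplier the Lagrangian of the selected maximisers is the dual function, and by strong
  duality the reference value is the minimum of the dual function.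
\<close>

lemma opt_gap_eq:
  assumes "rs_setting K c D" "argmax_selection K c D sel" "rs_optimal K c D xs ss"
    "dual_optimal K c D ls"
  shows "opt_gap K c D sel xs ss ls l = dual_fun K c D l - dual_fun K c D ls"
    and "0 \<le> opt_gap K c D sel xs ss ls l"
proof -
  have "(\<Sum>k=1..K. ss k) = c"
    using assms(3) by (simp add: rs_optimal_def is_arg_max_def)
  then have "lagrangian K c D xs ss ls = (\<Sum>k=1..K. utility (D k) (xs k))"
    by (simp add: lagrangian_def sum_subtractf flip: inner_sum_left)
  then show eq: "opt_gap K c D sel xs ss ls l = dual_fun K c D l - dual_fun K c D ls"
    unfolding opt_gap_def lagrangian_selection[OF assms(2)]
    using strong_duality[OF assms(1,3,4)] by simp
  show "0 \<le> opt_gap K c D sel xs ss ls l"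
    unfolding eq using assms(4) by (simp add: dual_optimal_def dual_fun_def is_arg_min_linorder)
qed

lemma fst_alg_state: "fst (alg_state K c sel \<nu> \<gamma> w t) = multiplier K c sel \<nu> \<gamma> w (t - 1)"
  by (cases t) (simp_all add: multiplier_def Let_def case_prod_beta)

text \<open>
  The update is a heavy-ball step in which the subgradient of the dual function is perturbed by the
  total noise.
\<close>

lemma multiplier_Suc:
  "multiplier K c sel \<nu> \<gamma> w (Suc t) =
    multiplier K c sel \<nu> \<gamma> w t
    - \<nu> t *\<^sub>R (dual_subgradient K c sel (multiplier K c sel \<nu> \<gamma> w t) - (\<Sum>k=1..K. w k t))
    + \<gamma> *\<^sub>R (multiplier K c sel \<nu> \<gamma> w t - multiplier K c sel \<nu> \<gamma> w (t - 1))"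
  using fst_alg_state[of K c sel \<nu> \<gamma> w t]
  by (simp add: multiplier_def dual_subgradient_def Let_def case_prod_beta sum.distrib algebra_simps)

section \<open>Step-size condition and conclusion\<close>

text \<open>
  The upper bound on \<open>\<nu>\<close> is the larger root of the quadratic
  \<open>T B\<^sup>2 \<nu>\<^sup>2 + 2 G0 \<nu> - (1 - \<gamma>) M\<^sup>2\<close>.
\<close>

lemma stepsize_condition:
  fixes G0 B M \<gamma> \<nu> :: real
  assumes "0 \<le> G0" "0 < B" "0 < T" "0 \<le> G0\<^sup>2 + (1 - \<gamma>) * B\<^sup>2 * T * M\<^sup>2" "0 < \<nu>"
    and \<nu>: "\<nu> \<le> (sqrt (G0\<^sup>2 + (1 - \<gamma>) * B\<^sup>2 * T * M\<^sup>2) - G0) / (B\<^sup>2 * T)"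
  shows "T * \<nu>\<^sup>2 * B\<^sup>2 + 2 * \<nu> * G0 \<le> (1 - \<gamma>) * M\<^sup>2"
proof -
  have pos: "0 < B\<^sup>2 * T"
    using assms by simp
  have "\<nu> * (B\<^sup>2 * T) + G0 \<le> sqrt (G0\<^sup>2 + (1 - \<gamma>) * B\<^sup>2 * T * M\<^sup>2)"
    using \<nu> pos by (simp add: pos_le_divide_eq)
  then have "(\<nu> * (B\<^sup>2 * T) + G0)\<^sup>2 \<le> G0\<^sup>2 + (1 - \<gamma>) * B\<^sup>2 * T * M\<^sup>2"
    using power_mono[of "\<nu> * (B\<^sup>2 * T) + G0" _ 2] assms pos by fastforce
  then have "(B\<^sup>2 * T) * (T * \<nu>\<^sup>2 * B\<^sup>2 + 2 * \<nu> * G0) \<le> (B\<^sup>2 * T) * ((1 - \<gamma>) * M\<^sup>2)"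
    by (simp add: power2_eq_square algebra_simps)
  then show ?thesis
    using pos by (simp only: mult_le_cancel_left_pos)
qed

text \<open>
  Compared with gradient descent without momentum, the regret bound carries the additional error
  \<open>\<gamma> / (1 - \<gamma>) (T \<nu>\<^sup>2 B\<^sup>2 + 2 \<nu> G0)\<close> but has only \<open>(1 - \<gamma>) M\<^sup>2\<close> in place of \<open>M\<^sup>2\<close>. The step-size
  condition says exactly that the error is at most the missing \<open>\<gamma> M\<^sup>2\<close>.
\<close>

lemma momentum_average_bound:
  fixes S e G0 B M \<gamma> \<nu> T :: real
  assumes regret: "2 * \<nu> / (1 - \<gamma>) * (S + \<gamma> / (1 - \<gamma>) * (e - G0))
      \<le> M\<^sup>2 + (\<nu> / (1 - \<gamma>))\<^sup>2 * (T * B\<^sup>2)"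
    and step: "T * \<nu>\<^sup>2 * B\<^sup>2 + 2 * \<nu> * G0 \<le> (1 - \<gamma>) * M\<^sup>2"
    and "0 \<le> e" "0 < \<nu>" "0 \<le> \<gamma>" "\<gamma> < 1"
  shows "2 * \<nu> * S \<le> M\<^sup>2 + T * \<nu>\<^sup>2 * B\<^sup>2"
proof -
  define \<eta> where "\<eta> = 1 - \<gamma>"
  have \<eta>: "0 < \<eta>" "\<gamma> = 1 - \<eta>" using assms by (auto simp: \<eta>_def)
  have "\<eta>\<^sup>2 * (2 * \<nu> / \<eta> * (S + \<gamma> / \<eta> * (e - G0))) \<le> \<eta>\<^sup>2 * (M\<^sup>2 + (\<nu> / \<eta>)\<^sup>2 * (T * B\<^sup>2))"
    using regret by (intro mult_left_mono) (auto simp: \<eta>_def)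
  moreover have "\<eta>\<^sup>2 * (2 * \<nu> / \<eta> * (S + \<gamma> / \<eta> * (e - G0))) = 2 * \<nu> * \<eta> * S + 2 * \<nu> * \<gamma> * (e - G0)"
    using \<eta>(1) by (simp add: power2_eq_square field_simps)
  moreover have "\<eta>\<^sup>2 * (M\<^sup>2 + (\<nu> / \<eta>)\<^sup>2 * (T * B\<^sup>2)) = \<eta>\<^sup>2 * M\<^sup>2 + \<nu>\<^sup>2 * (T * B\<^sup>2)"
    using \<eta>(1) by (simp add: power2_eq_square field_simps)
  ultimately have "2 * \<nu> * \<eta> * S + 2 * \<nu> * \<gamma> * (e - G0) \<le> \<eta>\<^sup>2 * M\<^sup>2 + \<nu>\<^sup>2 * (T * B\<^sup>2)"
    by (simp only:)
  then have "2 * \<nu> * \<eta> * S + 2 * \<nu> * \<gamma> * e \<le> 2 * \<nu> * \<gamma> * G0 + \<eta>\<^sup>2 * M\<^sup>2 + \<nu>\<^sup>2 * (T * B\<^sup>2)"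
    by (simp add: right_diff_distrib)
  moreover have "0 \<le> 2 * \<nu> * \<gamma> * e"
    using assms by simp
  moreover have "\<gamma> * (T * \<nu>\<^sup>2 * B\<^sup>2 + 2 * \<nu> * G0) \<le> \<gamma> * (\<eta> * M\<^sup>2)"
    using step assms by (intro mult_left_mono) (auto simp: \<eta>_def)
  ultimately have "\<eta> * (2 * \<nu> * S) \<le> \<eta> * (M\<^sup>2 + T * \<nu>\<^sup>2 * B\<^sup>2)"
    unfolding \<eta>(2) by (simp add: power2_eq_square algebra_simps)
  then show ?thesis
    using \<eta>(1) by (simp only: mult_le_cancel_left_pos)
qed

theorem theorem2p5:
  fixes K T :: nat
    and c :: "real^'m::finite"
    and D :: "nat \<Rightarrow> 'm dataset"
    and sel :: "nat \<Rightarrow> real^'m \<Rightarrow> (nat \<Rightarrow> real) \<times> (real^'m)"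
    and xs :: "nat \<Rightarrow> nat \<Rightarrow> real" and ss :: "nat \<Rightarrow> real^'m" and ls :: "real^'m"
    and P :: "'a measure"
    and \<omega> :: "nat \<Rightarrow> nat \<Rightarrow> 'a \<Rightarrow> real^'m"
    and \<epsilon> \<delta> \<gamma> \<nu> M B G0 :: real
    and G :: "nat \<Rightarrow> 'a \<Rightarrow> real"
  assumes "rs_setting K c D"
    and "argmax_selection K c D sel"
    and "rs_optimal K c D xs ss"
    and "dual_optimal K c D ls"
    and "\<epsilon> > 0" and "0 < \<delta>" and "\<delta> \<le> 1" and "T \<ge> 1" and "\<gamma> > 0"
    and "M > 0" and "norm (0 - ls) \<le> M"
    and "prob_space P"
    and "prob_space.indep_vars P (\<lambda>_. borel) (\<lambda>(k, j, t) a. \<omega> k t a $ j)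
           ({1..K} \<times> (UNIV :: 'm set) \<times> {..<T})"
    and "\<And>k j t. k \<in> {1..K} \<Longrightarrow> t < T \<Longrightarrow>
           distr P borel (\<lambda>a. \<omega> k t a $ j) =
             normal_law 0 (real T * real CARD('m) * (c $ j)\<^sup>2 / (2 * rho \<epsilon> \<delta>))"
    and "B = norm c * sqrt (real T * real CARD('m) * real K / (2 * rho \<epsilon> \<delta>) + (real K - 1)\<^sup>2)"
    and "\<And>t a. G t a = opt_gap K c D sel xs ss ls
                         (multiplier K c sel (\<lambda>_. \<nu>) \<gamma> (\<lambda>k t. \<omega> k t a) t)"
    and "G0 = opt_gap K c D sel xs ss ls 0"
    and "0 \<le> G0\<^sup>2 + (1 - \<gamma>) * B\<^sup>2 * real T * M\<^sup>2"
    and "0 < \<nu>"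
    and "\<nu> \<le> (sqrt (G0\<^sup>2 + (1 - \<gamma>) * B\<^sup>2 * real T * M\<^sup>2) - G0) / (B\<^sup>2 * real T)"
  shows "Min ((\<lambda>t. prob_space.expectation P (G t)) ` {0..T})
           \<le> M\<^sup>2 / (2 * real T * \<nu>) + \<nu> / 2 * B\<^sup>2"
proof -
  note setting = assms(1) and sel = assms(2) and primal = assms(3) and dual = assms(4)
  interpret prob_space P by fact
  define V where "V j = real T * real CARD('m) * (c $ j)\<^sup>2 / (2 * rho \<epsilon> \<delta>)" for j
  define l where "l t a = multiplier K c sel (\<lambda>_. \<nu>) \<gamma> (\<lambda>k t. \<omega> k t a) t" for t a
  let ?f = "dual_fun K c D" and ?R = "(real K - 1) * norm c"
  have K: "1 < K" and c: "0 \<le> c" "c \<noteq> 0"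
    using setting by (auto simp: rs_setting_def)
  have rho: "0 < rho \<epsilon> \<delta>"
    using assms(5,6,7) by (simp add: rho_def)
  have V: "0 \<le> V j" for j
    using rho by (simp add: V_def)
  have noise: "integrable P (\<lambda>a. \<omega> k t a $ j)" "expectation (\<lambda>a. \<omega> k t a $ j) = 0"
      "integrable P (\<lambda>a. (\<omega> k t a $ j)\<^sup>2)" "expectation (\<lambda>a. (\<omega> k t a $ j)\<^sup>2) = V j"
    if kt: "k \<in> {1..K}" "t < T" for k j t
  proof -
    have X: "random_variable borel (\<lambda>a. \<omega> k t a $ j)"
      using assms(13) kt by (fastforce simp: indep_vars_def)
    have law: "distr P borel (\<lambda>a. \<omega> k t a $ j) = normal_law 0 (V j)"
      unfolding V_def by (rule assms(14)[OF kt])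
    show "integrable P (\<lambda>a. \<omega> k t a $ j)" "expectation (\<lambda>a. \<omega> k t a $ j) = 0"
      "integrable P (\<lambda>a. (\<omega> k t a $ j)\<^sup>2)" "expectation (\<lambda>a. (\<omega> k t a $ j)\<^sup>2) = V j"
      using moments_of_normal_law[OF V X law] by simp_all
  qed
  interpret noisy_heavy_ball P ?f "dual_subgradient K c sel" \<omega> l K T \<gamma> \<nu> ?R V
  proof unfold_locales
    show "l 0 a = 0" for a
      by (simp add: l_def multiplier_def)
    show "l (Suc t) a = l t a - \<nu> *\<^sub>R (dual_subgradient K c sel (l t a) - (\<Sum>k=1..K. \<omega> k t a))
        + \<gamma> *\<^sub>R (l t a - l (t - 1) a)" for t a
      unfolding l_def by (rule multiplier_Suc)
  qed (use assms(13) noise dual_subgradient_inequality[OF sel] measurable_dual_subgradient[OF sel]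
      norm_dual_subgradient_le[OF sel K c(1)] in auto)
  define e where "e t = expectation (\<lambda>a. ?f (l t a)) - ?f ls" for t
  have G: "G t a = ?f (l t a) - ?f ls" "0 \<le> G t a" for t a
    using opt_gap_eq[OF setting sel primal dual] by (auto simp: assms(16) l_def)
  have EG: "expectation (G t) = e t" if "t \<le> T" for t
    using integrable_f_iterate[OF that] by (simp add: G(1)[abs_def] e_def prob_space)
  have G0: "e 0 = G0" "0 \<le> G0"
    using opt_gap_eq[OF setting sel primal dual, of 0]
    by (auto simp: assms(17) e_def start prob_space)
  \<comment> \<open>The constant \<open>B\<close> collects the squared subgradient bound and the total noise variance, so
  \<open>B\<^sup>2\<close> bounds the second moment of the noisy direction.\<close>
  have sum_V: "real K * (\<Sum>j\<in>UNIV. V j) =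
      (norm c)\<^sup>2 * (real T * real CARD('m) * real K / (2 * rho \<epsilon> \<delta>))"
    by (simp add: V_def norm_vec_def L2_set_def sum_nonneg sum_distrib_left sum_distrib_right
        sum_divide_distrib mult_ac)
  have B_sq: "B\<^sup>2 = ?R\<^sup>2 + real K * (\<Sum>j\<in>UNIV. V j)"
    unfolding sum_V assms(15) using rho by (simp add: power_mult_distrib distrib_left mult.commute)
  have "0 < real T * real CARD('m) * real K / (2 * rho \<epsilon> \<delta>)"
    using rho K \<open>T \<ge> 1\<close> by simp
  then have B: "0 < B"
    unfolding assms(15) using c(2) by (simp add: add_pos_nonneg)
  have step: "real T * \<nu>\<^sup>2 * B\<^sup>2 + 2 * \<nu> * G0 \<le> (1 - \<gamma>) * M\<^sup>2"
    using stepsize_condition[OF G0(2) B _ assms(18,19,20)] assms(8) by simp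
  \<comment> \<open>A positive step-size can satisfy the condition only if \<open>\<gamma> < 1\<close>.\<close>
  have "0 < real T * \<nu>\<^sup>2 * B\<^sup>2 + 2 * \<nu> * G0"
    using B G0(2) assms(8,19) by (intro add_pos_nonneg) auto
  with step have "0 < (1 - \<gamma>) * M\<^sup>2"
    by linarith
  then have \<gamma>: "\<gamma> < 1"
    by (simp add: zero_less_mult_iff)
  have "2 * \<nu> / (1 - \<gamma>) * ((\<Sum>t<T. e t) + \<gamma> / (1 - \<gamma>) * (e (T - 1) - e 0))
      \<le> (norm ls)\<^sup>2 + (\<nu> / (1 - \<gamma>))\<^sup>2 * (real T * B\<^sup>2)"
    unfolding B_sq e_def by (rule expected_regret) (use \<gamma> assms(8,9,19) in auto)
  also have "\<dots> \<le> M\<^sup>2 + (\<nu> / (1 - \<gamma>))\<^sup>2 * (real T * B\<^sup>2)"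
    using assms(11) by (simp add: power_mono)
  finally have regret: "2 * \<nu> / (1 - \<gamma>) * ((\<Sum>t<T. e t) + \<gamma> / (1 - \<gamma>) * (e (T - 1) - G0))
      \<le> M\<^sup>2 + (\<nu> / (1 - \<gamma>))\<^sup>2 * (real T * B\<^sup>2)"
    unfolding G0(1) .
  have "0 \<le> expectation (G (T - 1))"
    using G(2) by (intro integral_nonneg_AE) auto
  then have "0 \<le> e (T - 1)"
    by (simp add: EG)
  from momentum_average_bound[OF regret step this assms(19)] \<gamma> assms(9)
  have total: "2 * \<nu> * (\<Sum>t<T. e t) \<le> M\<^sup>2 + real T * \<nu>\<^sup>2 * B\<^sup>2"
    by simp
  let ?min = "Min ((\<lambda>t. expectation (G t)) ` {0..T})"
  have "?min \<le> e t" if "t < T" for t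
    using that EG[of t] by (intro Min_le) (auto intro!: rev_image_eqI[of t])
  then have "real T * ?min \<le> (\<Sum>t<T. e t)"
    using sum_mono[of "{..<T}" "\<lambda>_. ?min" e] by simp
  then have "2 * \<nu> * (real T * ?min) \<le> M\<^sup>2 + real T * \<nu>\<^sup>2 * B\<^sup>2"
    using total \<open>0 < \<nu>\<close> by (smt (verit) mult_left_mono)
  then have "?min * (2 * real T * \<nu>) \<le> M\<^sup>2 + real T * \<nu>\<^sup>2 * B\<^sup>2"
    by (simp add: mult_ac)
  then have "?min \<le> (M\<^sup>2 + real T * \<nu>\<^sup>2 * B\<^sup>2) / (2 * real T * \<nu>)"
    using \<open>T \<ge> 1\<close> \<open>0 < \<nu>\<close> by (subst pos_le_divide_eq) auto
  also have "\<dots> = M\<^sup>2 / (2 * real T * \<nu>) + \<nu> / 2 * B\<^sup>2"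
    using \<open>T \<ge> 1\<close> \<open>0 < \<nu>\<close> by (simp add: field_simps power2_eq_square)
  finally show ?thesis .
qed

end
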